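(* Let $\Gamma$ be a finite abelian group and $B\in\overline{\mathrm{GARI}}(\Gamma)$. The following diagram commutes: $$\begin{array}{ccc}\overline{\mathrm{GARI}}(\Gamma) & \xrightarrow{\ \mathrm{ganit}_v(B)\ } & \overline{\mathrm{GARI}}(\Gamma)\\ {\scriptstyle\exp_\times}\uparrow & & \uparrow{\scriptstyle\exp_\times}\\ \overline{\mathrm{ARI}}(\Gamma) & \xrightarrow{\ \mathrm{ganit}_v(B)\ } & \overline{\mathrm{ARI}}(\Gamma)\end{array}$$ that is, $\mathrm{ganit}_v(B)(\exp_\times(A))=\exp_\times(\mathrm{ganit}_v(B)(A))$ for all $A\in\overline{\mathrm{ARI}}(\Gamma)$.
   Context: Moulds. $\Gamma$ is a finite abelian group, written multiplicatively. A mould is a sequence $M=(M(x_1,\dots,x_m))_{m\ge 0}$ with $M(\emptyset)\in\mathbb{Q}$ and, for $m\ge1$, $M(x_1,\dots,x_m)$ a family of rational functions $M_{\sigma_1,\dots,\sigma_m}(x_1,\dots,x_m)\in\mathbb{Q}(x_1,\dots,x_m)$ indexed by $(\sigma_1,\dots,\sigma_m)\in\Gamma^{m}$. $\overline{\mathrm{BIMU}}(\Gamma)$ denotes the set of all moulds, with variables called $v_i$ and components written $M\binom{\sigma_1,\dots,\sigma_m}{v_1,\dots,v_m}$. It is a $\mathbb{Q}$-vector space componentwise and a unital associative algebra with product $(A\times B)_{\sigma_1,\dots,\sigma_m}(x_1,\dots,x_m)=\sum_{i=0}^m A_{\sigma_1,\dots,\sigma_i}(x_1,\dots,x_i)B_{\sigma_{i+1},\dots,\sigma_m}(x_{i+1},\dots,x_m)$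 and unit $I=(1,0,0,\dots)$. Put $\overline{\mathrm{ARI}}(\Gamma)=\{M: M(\emptyset)=0\}$ and $\overline{\mathrm{GARI}}(\Gamma)=\{M: M(\emptyset)=1\}$. The map $\exp_\times:\overline{\mathrm{ARI}}(\Gamma)\to\overline{\mathrm{GARI}}(\Gamma)$ is $\exp_\times(A)=\sum_{k\ge0}\frac1{k!}A^{\times k}$, where $A^{\times k}$ is the $k$-fold $\times$-power, $A^{\times0}=I$ (the sum is finite in each depth $m$). Words. Letters are pairs $\binom{\sigma}{v}$ with $\sigma\in\Gamma$ and $v$ a $\mathbb{Z}$-linear combination of $v_1,v_2,\dots$; words are finite sequences of letters, $\emptyset$ the empty word. For a word $\alpha=(\binom{\sigma_1}{w_1},\dots,\binom{\sigma_m}{w_m})$, $M(\alpha):=M_{\sigma_1,\dots,\sigma_m}(w_1,\dots,w_m)$ (only used when $w_1,\dots,w_m$ are linearly independent). Write $\omega_i=\binom{\sigma_i}{v_i}$ and $\mathbf v_r=(\omega_1,\dots,\omega_r)$. Flexions. For nonempty words $a=(\binom{\tau_1}{y_1},\dots,\binom{\tau_k}{y_k})$, $b=(\binom{\rho_1}{z_1},\dots,\binom{\rho_l}{z_l})$: $a\rceil_b$ is $a$ with its last letter replaced by $\binom{\tau_k\rho_1\cdots\rho_l}{y_k}$, and ${}_a\lfloor b=(\binom{\rho_1}{z_1-y_k},\dots,\binom{\rho_l}{z_l-y_k})$; moreover $a\rceil_\emptyset=a$, ${}_a\lfloor\emptyset=\emptyset$. The map $\mathrm{ganit}_v(B)$.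 For $B\in\overline{\mathrm{GARI}}(\Gamma)$, the $\mathbb{Q}$-linear map $\mathrm{ganit}_v(B):\overline{\mathrm{BIMU}}(\Gamma)\to\overline{\mathrm{BIMU}}(\Gamma)$ is given by $(\mathrm{ganit}_v(B)(A))(\emptyset)=A(\emptyset)$ and, for $r\ge1$, $$(\mathrm{ganit}_v(B)(A))(\mathbf v_r)=\sum_{s\ge1}\ \sum_{\substack{\mathbf v_r=a_1b_1\cdots a_sb_s\\ a_1,\dots,a_s\ne\emptyset\\ b_1,\dots,b_{s-1}\ne\emptyset}}B({}_{a_1}\lfloor b_1)\cdots B({}_{a_s}\lfloor b_s)\,A(a_1\rceil_{b_1}\cdots a_s\rceil_{b_s}).$$ It preserves $\overline{\mathrm{ARI}}(\Gamma)$ and $\overline{\mathrm{GARI}}(\Gamma)$. *)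

theory Defs
  imports
    Complex_Main
    "HOL-Library.FuncSet"
    "HOL-Library.Groups_Big_Fun"
    "HOL-Library.Poly_Mapping"
    "HOL-Computational_Algebra.Fraction_Field"
    "HOL-Algebra.Group"
begin

section \<open>Rational functions in the variables $v_1, v_2, \dots$\<close>

text \<open>
  Variables are numbered from 0: the variable $v_{i+1}$ (or $x_{i+1}$) is number \<open>i\<close>.
  A polynomial maps exponent vectors to coefficients.  All of the fields
  $\mathbb{Q}(x_1,\dots,x_m)$ are subfields of the one field \<open>ratfun\<close>.
\<close>

type_synonym mpoly = "(nat \<Rightarrow>\<^sub>0 nat) \<Rightarrow>\<^sub>0 rat"
type_synonym ratfun = "mpoly fract"

definition poly_vars :: "mpoly \<Rightarrow> nat set" where
  "poly_vars p = (\<Union>e\<in>Poly_Mapping.keys p. Poly_Mapping.keys e)"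

text \<open>\<open>ratfuns m\<close> is $\mathbb{Q}(x_1,\dots,x_m)$; in particular \<open>ratfuns 0\<close> is the prime
  field $\mathbb{Q}$.\<close>

definition ratfuns :: "nat \<Rightarrow> ratfun set" where
  "ratfuns m = {Fraction_Field.Fract p q | p q.
     q \<noteq> 0 \<and> poly_vars p \<subseteq> {..<m} \<and> poly_vars q \<subseteq> {..<m}}"

definition ratfun_const :: "rat \<Rightarrow> ratfun" where
  "ratfun_const c = Fraction_Field.Fract (Poly_Mapping.single 0 c) 1"

definition poly_subst :: "(nat \<Rightarrow> mpoly) \<Rightarrow> mpoly \<Rightarrow> mpoly" where
  "poly_subst w p = (\<Sum>e\<in>Poly_Mapping.keys p.
     Poly_Mapping.single 0 (Poly_Mapping.lookup p e) *
       (\<Prod>i\<in>Poly_Mapping.keys e. w i ^ Poly_Mapping.lookup e i))"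

text \<open>
  Substitution $f \mapsto f(w_0, w_1, \dots)$ into a rational function.  The value does not depend
  on the fraction \<open>p / q\<close> chosen to represent \<open>f\<close> (see \<open>ratfun_subst_Fract\<close> below), and it is
  unspecified if the denominator of every such fraction vanishes under the substitution.
\<close>

definition ratfun_subst :: "(nat \<Rightarrow> mpoly) \<Rightarrow> ratfun \<Rightarrow> ratfun" where
  "ratfun_subst w f = (THE g. \<exists>p q. f = Fraction_Field.Fract p q \<and> poly_subst w q \<noteq> 0 \<and>
     g = Fraction_Field.Fract (poly_subst w p) (poly_subst w q))"

lemma poly_subst_superset:
  assumes "finite S" "Poly_Mapping.keys p \<subseteq> S"
  shows "poly_subst w p = (\<Sum>e\<in>S. Poly_Mapping.single 0 (Poly_Mapping.lookup p e) *
       (\<Prod>i\<in>Poly_Mapping.keys e. w i ^ Poly_Mapping.lookup e i))"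
  unfolding poly_subst_def
  by (rule sum.mono_neutral_left) (use assms in \<open>auto simp: in_keys_iff\<close>)

lemma poly_subst_zero [simp]: "poly_subst w 0 = 0"
  by (simp add: poly_subst_def)

lemma poly_subst_add: "poly_subst w (p + q) = poly_subst w p + poly_subst w q"
proof -
  let ?S = "Poly_Mapping.keys p \<union> Poly_Mapping.keys q"
  have "Poly_Mapping.keys (p + q) \<subseteq> ?S" by (rule Poly_Mapping.keys_add)
  then show ?thesis
    by (simp add: poly_subst_superset[of ?S] lookup_add single_add distrib_right sum.distrib)
qed

lemma poly_subst_sum: "poly_subst w (sum f S) = (\<Sum>x\<in>S. poly_subst w (f x))"
  by (induction S rule: infinite_finite_induct) (auto simp: poly_subst_add)

lemma poly_subst_single:
  "poly_subst w (Poly_Mapping.single e c) = Poly_Mapping.single 0 c *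
     (\<Prod>i\<in>Poly_Mapping.keys e. w i ^ Poly_Mapping.lookup e i)"
  by (simp add: poly_subst_superset[of "{e}"])

lemma mpoly_eq_sum_single:
  fixes p :: mpoly
  shows "p = (\<Sum>e\<in>Poly_Mapping.keys p. Poly_Mapping.single e (Poly_Mapping.lookup p e))"
  by (rule poly_mapping_eqI) (auto simp: lookup_sum lookup_single when_def in_keys_iff)

lemma monom_subst_add:
  fixes w :: "nat \<Rightarrow> mpoly"
  shows "(\<Prod>i\<in>Poly_Mapping.keys (e + f). w i ^ Poly_Mapping.lookup (e + f) i) =
    (\<Prod>i\<in>Poly_Mapping.keys e. w i ^ Poly_Mapping.lookup e i) *
    (\<Prod>i\<in>Poly_Mapping.keys f. w i ^ Poly_Mapping.lookup f i)"
proof -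
  let ?S = "Poly_Mapping.keys e \<union> Poly_Mapping.keys f"
  have sup: "(\<Prod>i\<in>Poly_Mapping.keys g. w i ^ Poly_Mapping.lookup g i) =
    (\<Prod>i\<in>?S. w i ^ Poly_Mapping.lookup g i)" if "Poly_Mapping.keys g \<subseteq> ?S" for g
    by (rule prod.mono_neutral_left) (use that in \<open>auto simp: in_keys_iff\<close>)
  have ef: "Poly_Mapping.keys e \<subseteq> ?S" "Poly_Mapping.keys f \<subseteq> ?S" by auto
  show ?thesis
    unfolding sup[OF Poly_Mapping.keys_add] sup[OF ef(1)] sup[OF ef(2)]
    by (simp add: lookup_add power_add prod.distrib)
qed

lemma poly_subst_mult: "poly_subst w (p * q) = poly_subst w p * poly_subst w q"
proof -
  let ?s = "\<lambda>p e. Poly_Mapping.single e (Poly_Mapping.lookup p e) :: mpoly"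
  have single: "poly_subst w (Poly_Mapping.single e c * Poly_Mapping.single f d) =
      poly_subst w (Poly_Mapping.single e c) * poly_subst w (Poly_Mapping.single f d)" for e f c d
  proof -
    have const: "Poly_Mapping.single 0 (c * d) =
        (Poly_Mapping.single 0 c * Poly_Mapping.single 0 d :: mpoly)"
      by (simp add: mult_single)
    show ?thesis
      unfolding mult_single[of e c f d] poly_subst_single monom_subst_add const
      by (simp only: ac_simps)
  qed
  have expand: "poly_subst w r = (\<Sum>e\<in>Poly_Mapping.keys r. poly_subst w (?s r e))" for r
    unfolding poly_subst_single by (simp add: poly_subst_def)
  have "p * q = (\<Sum>e\<in>Poly_Mapping.keys p. ?s p e) * (\<Sum>f\<in>Poly_Mapping.keys q. ?s q f)"
    using mpoly_eq_sum_single[of p] mpoly_eq_sum_single[of q] by simp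
  also have "\<dots> = (\<Sum>e\<in>Poly_Mapping.keys p. \<Sum>f\<in>Poly_Mapping.keys q. ?s p e * ?s q f)"
    by (rule sum_product)
  also have "poly_subst w \<dots> = (\<Sum>e\<in>Poly_Mapping.keys p. \<Sum>f\<in>Poly_Mapping.keys q.
      poly_subst w (?s p e) * poly_subst w (?s q f))"
    by (simp only: poly_subst_sum single)
  also have "\<dots> = poly_subst w p * poly_subst w q"
    by (simp only: expand[of p] expand[of q] sum_product)
  finally show ?thesis .
qed

lemma ratfun_subst_Fract:
  assumes "poly_subst w q \<noteq> 0"
  shows "ratfun_subst w (Fraction_Field.Fract p q) =
    Fraction_Field.Fract (poly_subst w p) (poly_subst w q)"
  unfolding ratfun_subst_def
proof (rule the_equality)
  fix g
  assume "\<exists>p' q'. Fraction_Field.Fract p q = Fraction_Field.Fract p' q' \<and> poly_subst w q' \<noteq> 0 \<and>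
     g = Fraction_Field.Fract (poly_subst w p') (poly_subst w q')"
  then obtain p' q' where eq: "Fraction_Field.Fract p q = Fraction_Field.Fract p' q'"
    and q': "poly_subst w q' \<noteq> 0"
    and g: "g = Fraction_Field.Fract (poly_subst w p') (poly_subst w q')" by blast
  have "q \<noteq> 0" "q' \<noteq> 0" using assms q' by auto
  with eq have "p * q' = p' * q" by (simp add: eq_fract)
  then have "poly_subst w p * poly_subst w q' = poly_subst w p' * poly_subst w q"
    by (simp flip: poly_subst_mult)
  then show "g = Fraction_Field.Fract (poly_subst w p) (poly_subst w q)"
    using assms q' g by (simp add: eq_fract)
qed (use assms in blast)

section \<open>Words\<close>

type_synonym linform = "nat \<Rightarrow>\<^sub>0 int"
type_synonym 'g word = "('g \<times> linform) list"

definition linform_poly :: "linform \<Rightarrow> mpoly" where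
  "linform_poly u = (\<Sum>i\<in>Poly_Mapping.keys u.
     Poly_Mapping.single (Poly_Mapping.single i 1) (of_int (Poly_Mapping.lookup u i)))"

text \<open>The word $\mathbf{v}_r$ with upper entries \<open>\<sigma>\<close>, where \<open>r = length \<sigma>\<close>.\<close>

definition generic_word :: "'g list \<Rightarrow> 'g word" where
  "generic_word \<sigma> = zip \<sigma> (map (\<lambda>i. Poly_Mapping.single i 1) [0..<length \<sigma>])"

section \<open>Moulds\<close>

text \<open>The function \<open>M\<close> sends $(\sigma_1,\dots,\sigma_m)$ to the rational function
  $M_{\sigma_1,\dots,\sigma_m}(x_1,\dots,x_m)$.\<close>

type_synonym 'g mould = "'g list \<Rightarrow> ratfun"

definition BIMU :: "('g, 'b) monoid_scheme \<Rightarrow> 'g mould set" where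
  "BIMU G = (\<Pi>\<^sub>E \<sigma>\<in>lists (carrier G). ratfuns (length \<sigma>))"

definition ARI :: "('g, 'b) monoid_scheme \<Rightarrow> 'g mould set" where
  "ARI G = {M \<in> BIMU G. M [] = 0}"

definition GARI :: "('g, 'b) monoid_scheme \<Rightarrow> 'g mould set" where
  "GARI G = {M \<in> BIMU G. M [] = 1}"

text \<open>\<open>mould_at M \<alpha>\<close> is $M(\alpha)$: the \<open>i\<close>-th variable of the component of \<open>M\<close> given by the
  upper entries is replaced by the \<open>i\<close>-th lower entry of \<open>\<alpha>\<close>.\<close>

definition mould_at :: "'g mould \<Rightarrow> 'g word \<Rightarrow> ratfun" where
  "mould_at M \<alpha> = ratfun_subst
     (\<lambda>i. if i < length \<alpha> then linform_poly (snd (\<alpha> ! i)) else 0) (M (map fst \<alpha>))"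

definition mould_one :: "('g, 'b) monoid_scheme \<Rightarrow> 'g mould" where
  "mould_one G = (\<lambda>\<sigma>\<in>lists (carrier G). if \<sigma> = [] then 1 else 0)"

definition mould_times :: "('g, 'b) monoid_scheme \<Rightarrow> 'g mould \<Rightarrow> 'g mould \<Rightarrow> 'g mould" where
  "mould_times G A B = (\<lambda>\<sigma>\<in>lists (carrier G). \<Sum>i\<le>length \<sigma>.
     mould_at A (take i (generic_word \<sigma>)) * mould_at B (drop i (generic_word \<sigma>)))"

definition mould_power :: "('g, 'b) monoid_scheme \<Rightarrow> 'g mould \<Rightarrow> nat \<Rightarrow> 'g mould" where
  "mould_power G A k = (mould_times G A ^^ k) (mould_one G)"

text \<open>\<^const>\<open>Sum_any\<close> is the sum over all \<open>k\<close> of a family with finite support.\<close>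

definition exp_times :: "('g, 'b) monoid_scheme \<Rightarrow> 'g mould \<Rightarrow> 'g mould" where
  "exp_times G A = (\<lambda>\<sigma>\<in>lists (carrier G).
     Sum_any (\<lambda>k. ratfun_const (1 / fact k) * mould_power G A k \<sigma>))"

section \<open>Flexions and \<open>ganit\<close>\<close>

text \<open>\<open>flex_upper G a b\<close> is $a\rceil_b$ and \<open>flex_lower a b\<close> is ${}_a\lfloor b$.\<close>

definition flex_upper :: "('g, 'b) monoid_scheme \<Rightarrow> 'g word \<Rightarrow> 'g word \<Rightarrow> 'g word" where
  "flex_upper G a b = (if a = [] \<or> b = [] then a
     else butlast a @ [(foldl (mult G) (fst (last a)) (map fst b), snd (last a))])"

definition flex_lower :: "'g word \<Rightarrow> 'g word \<Rightarrow> 'g word" where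
  "flex_lower a b = map (\<lambda>(\<rho>, z). (\<rho>, z - snd (last a))) b"

text \<open>The decompositions $w = a_1 b_1 \cdots a_s b_s$ with $s \ge 1$, all $a_i$ nonempty and all
  $b_i$ except possibly $b_s$ nonempty, as lists $[(a_1,b_1),\dots,(a_s,b_s)]$.\<close>

definition ganit_decomps :: "'g word \<Rightarrow> ('g word \<times> 'g word) list set" where
  "ganit_decomps w = {d. d \<noteq> [] \<and> concat (map (\<lambda>(a, b). a @ b) d) = w \<and>
     (\<forall>(a, b)\<in>set d. a \<noteq> []) \<and> (\<forall>(a, b)\<in>set (butlast d). b \<noteq> [])}"

lemma finite_ganit_decomps: "finite (ganit_decomps w)"
proof -
  let ?cat = "\<lambda>d. concat (map (\<lambda>(a, b). a @ b) d)"
  let ?L = "{xs. set xs \<subseteq> set w \<and> length xs \<le> length w}"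
  let ?D = "{d. set d \<subseteq> ?L \<times> ?L \<and> length d \<le> length w}"
  have len: "length d \<le> length (?cat d)" if "\<forall>(a, b)\<in>set d. a \<noteq> []"
    for d :: "('a word \<times> 'a word) list"
    using that
  proof (induction d)
    case (Cons x d)
    obtain a b where x: "x = (a, b)" by (cases x)
    with Cons have "length d \<le> length (?cat d)" "length a > 0" by simp_all
    then have "length (x # d) \<le> length a + length b + length (?cat d)"
      unfolding list.size by linarith
    then show ?case by (simp add: x)
  qed simp
  have mem: "set a \<subseteq> set (?cat d) \<and> set b \<subseteq> set (?cat d) \<and>
      length a \<le> length (?cat d) \<and> length b \<le> length (?cat d)"
    if "(a, b) \<in> set d" for a b and d :: "('a word \<times> 'a word) list"
  proof -
    from that obtain ys zs where "d = ys @ (a, b) # zs" by (meson split_list)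
    then show ?thesis by auto
  qed
  have "ganit_decomps w \<subseteq> ?D"
  proof
    fix d assume "d \<in> ganit_decomps w"
    then have d: "?cat d = w" "\<forall>(a, b)\<in>set d. a \<noteq> []" by (simp_all add: ganit_decomps_def)
    have "x \<in> ?L \<times> ?L" if "x \<in> set d" for x
      using mem[of "fst x" "snd x" d] that unfolding d(1) by (simp add: mem_Times_iff)
    then have "set d \<subseteq> ?L \<times> ?L" by (rule subsetI)
    moreover have "length d \<le> length w" using len[OF d(2)] unfolding d(1) .
    ultimately show "d \<in> ?D" unfolding mem_Collect_eq ..
  qed
  moreover have "finite ?D"
    by (intro finite_lists_length_le finite_cartesian_product) simp_all
  ultimately show ?thesis by (rule finite_subset)
qed

definition ganit ::
  "('g, 'b) monoid_scheme \<Rightarrow> 'g mould \<Rightarrow> 'g mould \<Rightarrow> 'g mould" where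
  "ganit G B A = (\<lambda>\<sigma>\<in>lists (carrier G). if \<sigma> = [] then A []
     else \<Sum>d\<in>ganit_decomps (generic_word \<sigma>).
       (\<Prod>(a, b)\<leftarrow>d. mould_at B (flex_lower a b)) *
       mould_at A (concat (map (\<lambda>(a, b). flex_upper G a b) d)))"

end

theory Submission
  imports Defs
begin

text \<open>
  The map $\mathrm{ganit}_v(B)$ is an algebra homomorphism for $\times$, hence commutes with powers
  and, by linearity, with $\exp_\times$.  For multiplicativity, evaluate $A \times C$ at the word
  $a_1\rceil_{b_1}\cdots a_s\rceil_{b_s}$: each cut of this word is induced by a cut of
  $\mathbf{v}_r$ together with decompositions of both halves, and conversely.  A cut inside $a_i$
  creates a block with empty $b$, whose coefficient is $B(\emptyset) = 1$; the flexions see only the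
  last letter of $a_i$, so the other coefficients do not change.  Evaluation at a word commutes with
  sums and products because the lower entries of the words that occur are algebraically independent.
\<close>

section \<open>Substitution into polynomials\<close>

text \<open>Evaluation is a partial operation: \<open>ratfun_subst\<close> is a definite description
  that gives no usable value when the denominators vanish. Every identity between values of moulds
  therefore needs evidence that the words involved are admissible (\<open>good_word\<close>), and
  this evidence has to be supplied for cut words and for the words made by both flexions. A second
  obstacle is that products and \<open>ganit\<close> are defined only at the words v_r, while the
  right half of a cut v_r starts at a later variable. The defining sum of \<open>ganit\<close> must
  hence be proved at shifted words too (\<open>mould_at_ganit\<close>). Renaming variables commutes
  with both flexions: the upper one leaves the lower entries alone, the lower one is linear in them.
  Finally, the number of nonzero terms of the exponential series depends on the depth. The words at
  which powers of A are evaluated are never longer than v_r, so one truncation serves all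
  decompositions and the two sums can be exchanged.\<close>

definition pvar :: "nat \<Rightarrow> mpoly" where
  "pvar i = Poly_Mapping.single (Poly_Mapping.single i 1) 1"

lemma poly_vars_zero [simp]: "poly_vars 0 = {}"
  by (simp add: poly_vars_def)

lemma poly_vars_const [simp]: "poly_vars (Poly_Mapping.single 0 c) = {}"
  by (simp add: poly_vars_def)

lemma poly_vars_one [simp]: "poly_vars 1 = {}"
  by (simp add: poly_vars_def)

lemma poly_vars_single_subset:
  "poly_vars (Poly_Mapping.single e c) \<subseteq> Poly_Mapping.keys e"
  by (simp add: poly_vars_def)

lemma poly_vars_add: "poly_vars (p + q) \<subseteq> poly_vars p \<union> poly_vars q"
  using Poly_Mapping.keys_add[of p q] by (auto simp: poly_vars_def)

lemma poly_vars_mult: "poly_vars (p * q) \<subseteq> poly_vars p \<union> poly_vars q"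
proof
  fix i assume "i \<in> poly_vars (p * q)"
  then obtain e where "e \<in> Poly_Mapping.keys (p * q)" and i: "i \<in> Poly_Mapping.keys e"
    by (auto simp: poly_vars_def)
  then obtain a b where ab: "e = a + b" "a \<in> Poly_Mapping.keys p" "b \<in> Poly_Mapping.keys q"
    using Poly_Mapping.keys_mult[of p q] by blast
  with i have "i \<in> Poly_Mapping.keys a \<union> Poly_Mapping.keys b"
    using Poly_Mapping.keys_add[of a b] by blast
  with ab show "i \<in> poly_vars p \<union> poly_vars q"
    by (auto simp: poly_vars_def)
qed

lemma poly_vars_sum:
  assumes "\<And>x. x \<in> S \<Longrightarrow> poly_vars (f x) \<subseteq> V"
  shows "poly_vars (sum f S) \<subseteq> V"
  using assms
proof (induction S rule: infinite_finite_induct)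
  case (insert x S)
  then have "poly_vars (f x) \<union> poly_vars (sum f S) \<subseteq> V" by simp
  with insert.hyps poly_vars_add[of "f x" "sum f S"] show ?case by auto
qed simp_all

lemma poly_vars_prod:
  assumes "\<And>x. x \<in> S \<Longrightarrow> poly_vars (f x) \<subseteq> V"
  shows "poly_vars (prod f S) \<subseteq> V"
  using assms
proof (induction S rule: infinite_finite_induct)
  case (insert x S)
  then have "poly_vars (f x) \<union> poly_vars (prod f S) \<subseteq> V" by simp
  with insert.hyps poly_vars_mult[of "f x" "prod f S"] show ?case by auto
qed simp_all

lemma poly_vars_power: "poly_vars (p ^ n) \<subseteq> poly_vars p"
proof (induction n)
  case (Suc n)
  then show ?case using poly_vars_mult[of p "p ^ n"] by auto
qed simp

lemma poly_vars_subst: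
  assumes "\<And>i. i \<in> poly_vars p \<Longrightarrow> poly_vars (w i) \<subseteq> V"
  shows "poly_vars (poly_subst w p) \<subseteq> V"
  unfolding poly_subst_def
proof (rule poly_vars_sum)
  fix e assume e: "e \<in> Poly_Mapping.keys p"
  have "poly_vars (\<Prod>i\<in>Poly_Mapping.keys e. w i ^ Poly_Mapping.lookup e i) \<subseteq> V"
  proof (rule poly_vars_prod)
    fix i assume "i \<in> Poly_Mapping.keys e"
    with e have "poly_vars (w i) \<subseteq> V" by (intro assms) (auto simp: poly_vars_def)
    then show "poly_vars (w i ^ Poly_Mapping.lookup e i) \<subseteq> V"
      using poly_vars_power by blast
  qed
  then show "poly_vars (Poly_Mapping.single 0 (Poly_Mapping.lookup p e) *
      (\<Prod>i\<in>Poly_Mapping.keys e. w i ^ Poly_Mapping.lookup e i)) \<subseteq> V"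
    using poly_vars_mult by fastforce
qed

lemma poly_subst_const [simp]:
  "poly_subst w (Poly_Mapping.single 0 c) = Poly_Mapping.single 0 c"
  by (simp add: poly_subst_single)

lemma poly_subst_one [simp]: "poly_subst w 1 = 1"
  using poly_subst_const[of w 1] by simp

lemma poly_subst_pvar [simp]: "poly_subst w (pvar i) = w i"
  by (simp add: pvar_def poly_subst_single)

lemma poly_subst_prod: "poly_subst w (prod f S) = (\<Prod>x\<in>S. poly_subst w (f x))"
  by (induction S rule: infinite_finite_induct) (auto simp: poly_subst_mult)

lemma poly_subst_power: "poly_subst w (p ^ n) = poly_subst w p ^ n"
  by (induction n) (auto simp: poly_subst_mult)

lemma poly_subst_uminus: "poly_subst w (- p) = - poly_subst w p"
proof -
  have "poly_subst w (- p) + poly_subst w p = 0"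
    by (simp flip: poly_subst_add)
  then show ?thesis by (simp add: eq_neg_iff_add_eq_0)
qed

lemma poly_subst_diff: "poly_subst w (p - q) = poly_subst w p - poly_subst w q"
  using poly_subst_add[of w p "- q"] by (simp add: poly_subst_uminus)

lemma poly_subst_cong:
  assumes "\<And>i. i \<in> poly_vars p \<Longrightarrow> w i = w' i"
  shows "poly_subst w p = poly_subst w' p"
  unfolding poly_subst_def
proof (intro sum.cong refl arg_cong2[of _ _ _ _ "(*)"] prod.cong)
  fix e i assume "e \<in> Poly_Mapping.keys p" "i \<in> Poly_Mapping.keys e"
  then have "i \<in> poly_vars p" by (auto simp: poly_vars_def)
  then show "w i ^ Poly_Mapping.lookup e i = w' i ^ Poly_Mapping.lookup e i"
    by (simp add: assms)
qed

lemma poly_subst_subst: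
  "poly_subst u (poly_subst w p) = poly_subst (\<lambda>i. poly_subst u (w i)) p"
  by (simp add: poly_subst_def[of _ p] poly_subst_sum poly_subst_mult poly_subst_prod
      poly_subst_power)

lemma poly_subst_pvars: "poly_subst pvar p = p"
proof -
  have pow: "pvar i ^ n = Poly_Mapping.single (Poly_Mapping.single i n) 1" for i n
    by (induction n) (simp_all add: pvar_def mult_single flip: single_add)
  have prd: "(\<Prod>i\<in>S. Poly_Mapping.single (f i) 1 :: mpoly) = Poly_Mapping.single (sum f S) 1"
    for f and S :: "nat set"
    by (induction S rule: infinite_finite_induct) (simp_all add: mult_single)
  have mono: "(\<Sum>i\<in>Poly_Mapping.keys e. Poly_Mapping.single i (Poly_Mapping.lookup e i)) = e"
    for e :: "nat \<Rightarrow>\<^sub>0 nat"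
    by (rule poly_mapping_eqI) (auto simp: lookup_sum lookup_single when_def in_keys_iff)
  have "poly_subst pvar p =
      (\<Sum>e\<in>Poly_Mapping.keys p. Poly_Mapping.single e (Poly_Mapping.lookup p e))"
    unfolding poly_subst_def by (simp add: pow prd mono mult_single)
  then show ?thesis by (simp flip: mpoly_eq_sum_single)
qed

text \<open>A left inverse substitution witnesses the algebraic independence of
  \<open>w 0, \<dots>, w (m - 1)\<close>; for the words occurring here it can be written down directly.\<close>

definition subst_indep :: "nat \<Rightarrow> (nat \<Rightarrow> mpoly) \<Rightarrow> bool" where
  "subst_indep m w \<longleftrightarrow> (\<exists>u. \<forall>i<m. poly_subst u (w i) = pvar i)"

lemma subst_indep_left_inverse:
  assumes "\<forall>i<m. poly_subst u (w i) = pvar i" and "poly_vars p \<subseteq> {..<m}"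
  shows "poly_subst u (poly_subst w p) = p"
proof -
  have "poly_subst u (poly_subst w p) = poly_subst pvar p"
    unfolding poly_subst_subst by (rule poly_subst_cong) (use assms in auto)
  then show ?thesis by (simp add: poly_subst_pvars)
qed

text \<open>The left inverse would send a vanishing image back to \<open>q\<close>. This keeps
  denominators alive, so that \<open>ratfun_subst\<close> takes the expected value on all of
  \<open>ratfuns m\<close>.\<close>

lemma subst_indep_nonzero:
  assumes "subst_indep m w" "poly_vars q \<subseteq> {..<m}" "q \<noteq> 0"
  shows "poly_subst w q \<noteq> 0"
  using assms subst_indep_left_inverse unfolding subst_indep_def by (metis poly_subst_zero)

lemma subst_indep_comp:
  assumes "subst_indep m v" "subst_indep n w" "\<And>i. i < m \<Longrightarrow> poly_vars (v i) \<subseteq> {..<n}"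
  shows "subst_indep m (\<lambda>i. poly_subst w (v i))"
proof -
  obtain u where u: "\<forall>i<m. poly_subst u (v i) = pvar i"
    using assms(1) by (auto simp: subst_indep_def)
  obtain u' where u': "\<forall>i<n. poly_subst u' (w i) = pvar i"
    using assms(2) by (auto simp: subst_indep_def)
  \<comment> \<open>Left inverses compose in reverse order: \<open>u'\<close> undoes
    \<open>w\<close>, which works because \<open>v i\<close> only involves the first
    \<open>n\<close> variables, and \<open>u\<close> then undoes \<open>v\<close>.\<close>
  have "\<forall>i<m. poly_subst (\<lambda>i. poly_subst u (u' i)) (poly_subst w (v i)) = pvar i"
    using subst_indep_left_inverse[OF u'] assms(3) u by (simp flip: poly_subst_subst)
  then show ?thesis unfolding subst_indep_def by blast
qed

section \<open>Substitution into rational functions\<close>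

lemma ratfunsE:
  assumes "f \<in> ratfuns m"
  obtains p q where "f = Fraction_Field.Fract p q" "q \<noteq> 0"
    "poly_vars p \<subseteq> {..<m}" "poly_vars q \<subseteq> {..<m}"
  using assms unfolding ratfuns_def by blast

lemma ratfunsI:
  assumes "q \<noteq> 0" "poly_vars p \<subseteq> {..<m}" "poly_vars q \<subseteq> {..<m}"
  shows "Fraction_Field.Fract p q \<in> ratfuns m"
  using assms unfolding ratfuns_def by blast

lemma ratfuns_zero [simp]: "0 \<in> ratfuns m"
  unfolding Zero_fract_def by (rule ratfunsI) simp_all

lemma ratfuns_one [simp]: "1 \<in> ratfuns m"
  unfolding One_fract_def by (rule ratfunsI) simp_all

lemma ratfuns_const [simp]: "ratfun_const c \<in> ratfuns m"
  unfolding ratfun_const_def by (rule ratfunsI) simp_all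

lemma ratfuns_add:
  assumes "f \<in> ratfuns m" "g \<in> ratfuns m"
  shows "f + g \<in> ratfuns m"
proof -
  obtain p q where f: "f = Fraction_Field.Fract p q" "q \<noteq> 0"
    "poly_vars p \<subseteq> {..<m}" "poly_vars q \<subseteq> {..<m}" using assms(1) by (rule ratfunsE)
  obtain p' q' where g: "g = Fraction_Field.Fract p' q'" "q' \<noteq> 0"
    "poly_vars p' \<subseteq> {..<m}" "poly_vars q' \<subseteq> {..<m}" using assms(2) by (rule ratfunsE)
  have "poly_vars (p * q' + p' * q) \<subseteq> {..<m}" "poly_vars (q * q') \<subseteq> {..<m}"
    using f g poly_vars_add[of "p * q'" "p' * q"] poly_vars_mult[of p q'] poly_vars_mult[of p' q]
      poly_vars_mult[of q q'] by blast+
  with f g show ?thesis by (simp add: ratfunsI)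
qed

lemma ratfuns_mult:
  assumes "f \<in> ratfuns m" "g \<in> ratfuns m"
  shows "f * g \<in> ratfuns m"
proof -
  obtain p q where f: "f = Fraction_Field.Fract p q" "q \<noteq> 0"
    "poly_vars p \<subseteq> {..<m}" "poly_vars q \<subseteq> {..<m}" using assms(1) by (rule ratfunsE)
  obtain p' q' where g: "g = Fraction_Field.Fract p' q'" "q' \<noteq> 0"
    "poly_vars p' \<subseteq> {..<m}" "poly_vars q' \<subseteq> {..<m}" using assms(2) by (rule ratfunsE)
  have "poly_vars (p * p') \<subseteq> {..<m}" "poly_vars (q * q') \<subseteq> {..<m}"
    using f g poly_vars_mult[of p p'] poly_vars_mult[of q q'] by blast+
  with f g show ?thesis by (simp add: ratfunsI)
qed

lemma ratfuns_sum: "(\<And>x. x \<in> S \<Longrightarrow> f x \<in> ratfuns m) \<Longrightarrow> sum f S \<in> ratfuns m"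
  by (induction S rule: infinite_finite_induct) (auto intro: ratfuns_add)

lemma ratfuns_prod_list: "(\<And>x. x \<in> set xs \<Longrightarrow> x \<in> ratfuns m) \<Longrightarrow> prod_list xs \<in> ratfuns m"
  by (induction xs) (auto intro: ratfuns_mult)

lemma ratfun_subst_const [simp]: "ratfun_subst w (ratfun_const c) = ratfun_const c"
  unfolding ratfun_const_def by (simp add: ratfun_subst_Fract)

lemma ratfun_subst_zero [simp]: "ratfun_subst w 0 = 0"
  unfolding Zero_fract_def by (simp add: ratfun_subst_Fract)

lemma ratfun_subst_one [simp]: "ratfun_subst w 1 = 1"
  unfolding One_fract_def by (simp add: ratfun_subst_Fract)

lemma ratfun_subst_add:
  assumes "subst_indep m w" "f \<in> ratfuns m" "g \<in> ratfuns m"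
  shows "ratfun_subst w (f + g) = ratfun_subst w f + ratfun_subst w g"
proof -
  obtain p q where f: "f = Fraction_Field.Fract p q" "q \<noteq> 0" "poly_vars q \<subseteq> {..<m}"
    using assms(2) by (rule ratfunsE)
  obtain p' q' where g: "g = Fraction_Field.Fract p' q'" "q' \<noteq> 0" "poly_vars q' \<subseteq> {..<m}"
    using assms(3) by (rule ratfunsE)
  have "poly_subst w q \<noteq> 0" "poly_subst w q' \<noteq> 0"
    using f g assms(1) by (auto dest: subst_indep_nonzero)
  with f g show ?thesis
    by (simp add: ratfun_subst_Fract poly_subst_mult poly_subst_add)
qed

lemma ratfun_subst_mult:
  assumes "subst_indep m w" "f \<in> ratfuns m" "g \<in> ratfuns m"
  shows "ratfun_subst w (f * g) = ratfun_subst w f * ratfun_subst w g"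
proof -
  obtain p q where f: "f = Fraction_Field.Fract p q" "q \<noteq> 0" "poly_vars q \<subseteq> {..<m}"
    using assms(2) by (rule ratfunsE)
  obtain p' q' where g: "g = Fraction_Field.Fract p' q'" "q' \<noteq> 0" "poly_vars q' \<subseteq> {..<m}"
    using assms(3) by (rule ratfunsE)
  have "poly_subst w q \<noteq> 0" "poly_subst w q' \<noteq> 0"
    using f g assms(1) by (auto dest: subst_indep_nonzero)
  with f g show ?thesis
    by (simp add: ratfun_subst_Fract poly_subst_mult)
qed

lemma ratfun_subst_sum:
  assumes "subst_indep m w" "\<And>x. x \<in> S \<Longrightarrow> f x \<in> ratfuns m"
  shows "ratfun_subst w (sum f S) = (\<Sum>x\<in>S. ratfun_subst w (f x))"
  using assms(2)
  by (induction S rule: infinite_finite_induct)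
    (auto simp: ratfun_subst_add[OF assms(1)] ratfuns_sum)

lemma ratfun_subst_prod_list:
  assumes "subst_indep m w" "\<And>x. x \<in> set xs \<Longrightarrow> x \<in> ratfuns m"
  shows "ratfun_subst w (prod_list xs) = prod_list (map (ratfun_subst w) xs)"
  using assms(2)
  by (induction xs) (auto simp: ratfun_subst_mult[OF assms(1)] ratfuns_prod_list)

lemma ratfun_subst_in_ratfuns:
  assumes "subst_indep m w" "\<And>i. i < m \<Longrightarrow> poly_vars (w i) \<subseteq> {..<n}" "f \<in> ratfuns m"
  shows "ratfun_subst w f \<in> ratfuns n"
proof -
  obtain p q where f: "f = Fraction_Field.Fract p q" "q \<noteq> 0"
    "poly_vars p \<subseteq> {..<m}" "poly_vars q \<subseteq> {..<m}" using assms(3) by (rule ratfunsE)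
  have nz: "poly_subst w q \<noteq> 0" using f assms(1) by (auto dest: subst_indep_nonzero)
  have "poly_vars (poly_subst w r) \<subseteq> {..<n}" if "poly_vars r \<subseteq> {..<m}" for r
    by (rule poly_vars_subst, rule assms(2)) (use that in auto)
  with nz f show ?thesis by (simp add: ratfun_subst_Fract ratfunsI)
qed

lemma ratfun_subst_subst:
  assumes "subst_indep m v" "subst_indep n w" "\<And>i. i < m \<Longrightarrow> poly_vars (v i) \<subseteq> {..<n}"
    and "f \<in> ratfuns m"
  shows "ratfun_subst w (ratfun_subst v f) = ratfun_subst (\<lambda>i. poly_subst w (v i)) f"
proof -
  obtain p q where f: "f = Fraction_Field.Fract p q" "q \<noteq> 0" "poly_vars q \<subseteq> {..<m}"
    using assms(4) by (rule ratfunsE)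
  have "poly_subst v q \<noteq> 0" using f assms(1) by (auto dest: subst_indep_nonzero)
  moreover have "poly_subst w (poly_subst v q) \<noteq> 0"
    using subst_indep_nonzero[OF subst_indep_comp[OF assms(1-3)] f(3,2)]
    by (simp add: poly_subst_subst)
  ultimately show ?thesis
    using f by (simp add: ratfun_subst_Fract poly_subst_subst)
qed

text \<open>Needed because \<open>lower_subst\<close> is padded with 0 beyond the end of the word,
  whereas a renaming of variables acts on all of them.\<close>

lemma ratfun_subst_cong:
  assumes "f \<in> ratfuns m" "subst_indep m w" "\<And>i. i < m \<Longrightarrow> w' i = w i"
  shows "ratfun_subst w' f = ratfun_subst w f"
proof -
  obtain p q where f: "f = Fraction_Field.Fract p q" "q \<noteq> 0"
    "poly_vars p \<subseteq> {..<m}" "poly_vars q \<subseteq> {..<m}" using assms(1) by (rule ratfunsE)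
  have eq: "poly_subst w' r = poly_subst w r" if "poly_vars r \<subseteq> {..<m}" for r
    by (rule poly_subst_cong) (use that assms(3) in auto)
  have "poly_subst w q \<noteq> 0" using f assms(2) by (auto dest: subst_indep_nonzero)
  then show ?thesis by (simp add: f(1) ratfun_subst_Fract eq f)
qed

lemma ratfun_subst_pvars:
  assumes "f \<in> ratfuns m" "\<And>i. i < m \<Longrightarrow> w i = pvar i"
  shows "ratfun_subst w f = f"
proof -
  obtain p q where f: "f = Fraction_Field.Fract p q" "q \<noteq> 0" using assms(1) by (rule ratfunsE)
  have "subst_indep m pvar" unfolding subst_indep_def by (rule exI[of _ pvar]) simp
  from ratfun_subst_cong[OF assms(1) this assms(2)] show ?thesis
    using f by (simp add: ratfun_subst_Fract poly_subst_pvars)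
qed

section \<open>Evaluation of moulds at words\<close>

lemma linform_poly_zero [simp]: "linform_poly 0 = 0"
  by (simp add: linform_poly_def)

lemma linform_poly_frag_of [simp]: "linform_poly (frag_of i) = pvar i"
  by (simp add: pvar_def linform_poly_def)

lemma linform_poly_superset:
  assumes "finite S" "Poly_Mapping.keys u \<subseteq> S"
  shows "linform_poly u = (\<Sum>i\<in>S.
     Poly_Mapping.single (Poly_Mapping.single i 1) (of_int (Poly_Mapping.lookup u i)))"
  unfolding linform_poly_def
  by (rule sum.mono_neutral_left) (use assms in \<open>auto simp: in_keys_iff\<close>)

lemma linform_poly_diff: "linform_poly (u - v) = linform_poly u - linform_poly v"
proof -
  let ?S = "Poly_Mapping.keys u \<union> Poly_Mapping.keys v"
  have "Poly_Mapping.keys (u - v) \<subseteq> ?S" by (rule keys_diff)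
  then show ?thesis
    by (simp add: linform_poly_superset[of ?S] lookup_minus single_diff sum_subtractf)
qed

text \<open>Linear forms are elements of a free abelian group, and \<open>frag_extend t\<close> is
  the linear map with values \<open>t\<close> on the generators. Both sides respect differences and
  agree on generators. This turns substitutions into polynomials into operations on words.\<close>

lemma linform_poly_frag_extend:
  "linform_poly (frag_extend t u) = poly_subst (linform_poly \<circ> t) (linform_poly u)"
  using subset_UNIV
  by (induction u rule: frag_induction)
    (simp_all add: frag_extend_diff linform_poly_diff poly_subst_diff)

lemma poly_vars_linform_poly: "poly_vars (linform_poly u) \<subseteq> Poly_Mapping.keys u"
  unfolding linform_poly_def
  by (rule poly_vars_sum, rule order_trans[OF poly_vars_single_subset]) auto

definition lower_subst :: "'g word \<Rightarrow> nat \<Rightarrow> mpoly" where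
  "lower_subst \<alpha> i = (if i < length \<alpha> then linform_poly (snd (\<alpha> ! i)) else 0)"

lemma mould_at_eq: "mould_at M \<alpha> = ratfun_subst (lower_subst \<alpha>) (M (map fst \<alpha>))"
  unfolding mould_at_def lower_subst_def ..

text \<open>The words at which evaluation behaves well. The bound \<open>n\<close> on the variables
  is separate from the number of letters: factors and flexions of v_r may have fewer than r letters,
  yet their values must all lie in the common field \<open>ratfuns n\<close> with n = r.\<close>

definition good_word :: "('g, 'b) monoid_scheme \<Rightarrow> nat \<Rightarrow> 'g word \<Rightarrow> bool" where
  "good_word G n \<alpha> \<longleftrightarrow> map fst \<alpha> \<in> lists (carrier G) \<and>
     subst_indep (length \<alpha>) (lower_subst \<alpha>) \<and>
     (\<forall>u\<in>set (map snd \<alpha>). Poly_Mapping.keys u \<subseteq> {..<n})"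

definition word_map :: "(nat \<Rightarrow> linform) \<Rightarrow> 'g word \<Rightarrow> 'g word" where
  "word_map t \<alpha> = map (apsnd (frag_extend t)) \<alpha>"

lemma map_fst_word_map [simp]: "map fst (word_map t \<alpha>) = map fst \<alpha>"
  by (simp add: word_map_def)

lemma word_map_append [simp]: "word_map t (\<alpha> @ \<beta>) = word_map t \<alpha> @ word_map t \<beta>"
  by (simp add: word_map_def)

lemma BIMU_D: "M \<in> BIMU G \<Longrightarrow> \<sigma> \<in> lists (carrier G) \<Longrightarrow> M \<sigma> \<in> ratfuns (length \<sigma>)"
  by (auto simp: BIMU_def dest: PiE_mem)

lemma good_word_poly_vars:
  assumes "good_word G n \<alpha>" "i < length \<alpha>"
  shows "poly_vars (lower_subst \<alpha> i) \<subseteq> {..<n}"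
  using assms poly_vars_linform_poly[of "snd (\<alpha> ! i)"]
  by (fastforce simp: good_word_def lower_subst_def)

lemma good_word_BIMU:
  assumes "good_word G n \<alpha>" "M \<in> BIMU G"
  shows "M (map fst \<alpha>) \<in> ratfuns (length \<alpha>)"
proof -
  have "map fst \<alpha> \<in> lists (carrier G)" using assms(1) unfolding good_word_def by blast
  from BIMU_D[OF assms(2) this] show ?thesis by simp
qed

lemma mould_at_in_ratfuns:
  assumes "M \<in> BIMU G" "good_word G n \<alpha>"
  shows "mould_at M \<alpha> \<in> ratfuns n"
  unfolding mould_at_eq
proof (rule ratfun_subst_in_ratfuns)
  show "subst_indep (length \<alpha>) (lower_subst \<alpha>)" using assms(2) by (simp add: good_word_def)
qed (rule good_word_poly_vars[OF assms(2)] good_word_BIMU[OF assms(2,1)], assumption?)+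

text \<open>Two successive substitutions are one substitution, and on lower entries the composite is
  \<open>word_map t\<close>.\<close>

lemma ratfun_subst_mould_at:
  assumes "M \<in> BIMU G" "good_word G n \<beta>" "subst_indep n (linform_poly \<circ> t)"
  shows "ratfun_subst (linform_poly \<circ> t) (mould_at M \<beta>) = mould_at M (word_map t \<beta>)"
proof -
  have "lower_subst (word_map t \<beta>) = (\<lambda>i. poly_subst (linform_poly \<circ> t) (lower_subst \<beta> i))"
    by (auto simp: lower_subst_def word_map_def linform_poly_frag_extend)
  moreover have "subst_indep (length \<beta>) (lower_subst \<beta>)"
    using assms(2) by (simp add: good_word_def)
  ultimately show ?thesis
    unfolding mould_at_eq
    by (simp add: ratfun_subst_subst[OF _ assms(3) good_word_poly_vars[OF assms(2)]
        good_word_BIMU[OF assms(2,1)]])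
qed

lemma length_generic_word [simp]: "length (generic_word \<sigma>) = length \<sigma>"
  by (simp add: generic_word_def)

lemma map_fst_generic_word [simp]: "map fst (generic_word \<sigma>) = \<sigma>"
  by (simp add: generic_word_def)

lemma map_snd_generic_word: "map snd (generic_word \<sigma>) = map frag_of [0..<length \<sigma>]"
  by (simp add: generic_word_def)

lemma generic_word_Nil [simp]: "generic_word [] = []"
  by (simp add: generic_word_def)

lemma nth_generic_word: "i < length \<sigma> \<Longrightarrow> generic_word \<sigma> ! i = (\<sigma> ! i, frag_of i)"
  by (simp add: generic_word_def)

lemma mould_at_generic_word:
  assumes "M \<in> BIMU G" "\<sigma> \<in> lists (carrier G)"
  shows "mould_at M (generic_word \<sigma>) = M \<sigma>"
  unfolding mould_at_eq
  by (simp, rule ratfun_subst_pvars[OF BIMU_D[OF assms]])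
    (simp add: lower_subst_def nth_generic_word)

lemma mould_at_Nil: "M \<in> BIMU G \<Longrightarrow> mould_at M [] = M []"
  using mould_at_generic_word[of M G "[]"] by simp

lemma word_map_generic_word:
  "word_map (\<lambda>i. if i < length \<alpha> then snd (\<alpha> ! i) else 0) (generic_word (map fst \<alpha>)) = \<alpha>"
  by (rule nth_equalityI) (simp_all add: word_map_def nth_generic_word)

text \<open>The trivial renaming is written out as \<open>frag_of \<circ> id\<close> so that
  prefixes and suffixes both appear as injective renamings of generic words.\<close>

lemma take_generic_word:
  "take i (generic_word \<sigma>) = word_map (frag_of \<circ> id) (generic_word (take i \<sigma>))"
  by (rule nth_equalityI) (simp_all add: word_map_def nth_generic_word)

lemma drop_generic_word:
  "drop i (generic_word \<sigma>) = word_map (frag_of \<circ> (+) i) (generic_word (drop i \<sigma>))"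
  by (rule nth_equalityI) (simp_all add: word_map_def nth_generic_word)

text \<open>The case \<open>c = 0\<close> covers the arguments of the evaluated mould, the other case those of the
  coefficients, i.e. the lower flexions.\<close>

lemma good_word_diff:
  assumes "map fst \<alpha> \<in> lists (carrier G)" "map snd \<alpha> = map (\<lambda>k. frag_of k - c) ks"
    and ks: "distinct ks" "set ks \<subseteq> {..<n}"
    and c: "c = 0 \<or> (\<exists>y<n. y \<notin> set ks \<and> c = frag_of y)"
  shows "good_word G n \<alpha>"
proof -
  have len: "length ks = length \<alpha>" using assms(2) by (metis length_map)
  \<comment> \<open>The left inverse sends the variable numbered \<open>ks ! i\<close> to the
    variable numbered \<open>i\<close> and every variable outside \<open>ks\<close> to 0. It thus
    kills \<open>c\<close>, and the difference of \<open>ks ! i\<close> and \<open>c\<close> goes to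
    the variable numbered \<open>i\<close>.\<close>
  define u where "u = (\<lambda>x. case map_of (zip ks [0..<length ks]) x of None \<Rightarrow> 0 | Some i \<Rightarrow> pvar i)"
  have u_nth: "u (ks ! i) = pvar i" if "i < length ks" for i
  proof -
    have "map_of (zip ks [0..<length ks]) (ks ! i) = Some ([0..<length ks] ! i)"
      by (rule map_of_zip_nth) (use ks(1) that in auto)
    with that show ?thesis by (simp add: u_def)
  qed
  have u_notin: "u y = 0" if "y \<notin> set ks" for y
  proof -
    have "map_of (zip ks [0..<length ks]) y = None"
      using that by (auto simp: map_of_eq_None_iff dest: set_zip_leftD)
    then show ?thesis unfolding u_def by (simp only: option.case)
  qed
  have uc: "poly_subst u (linform_poly c) = 0" using c u_notin by auto
  have snd_nth: "snd (\<alpha> ! i) = frag_of (ks ! i) - c" if "i < length \<alpha>" for i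
    using that len arg_cong[OF assms(2), of "\<lambda>xs. xs ! i"] by simp
  have "\<forall>i<length \<alpha>. poly_subst u (lower_subst \<alpha> i) = pvar i"
    using u_nth len
    by (simp add: lower_subst_def snd_nth linform_poly_diff poly_subst_diff uc)
  then have "subst_indep (length \<alpha>) (lower_subst \<alpha>)"
    unfolding subst_indep_def by blast
  moreover have "Poly_Mapping.keys u \<subseteq> {..<n}" if "u \<in> set (map snd \<alpha>)" for u
  proof -
    from that obtain k where k: "k \<in> set ks" "u = frag_of k - c"
      unfolding assms(2) by auto
    have "Poly_Mapping.keys u \<subseteq> {k} \<union> Poly_Mapping.keys c"
      unfolding k(2) using keys_diff[of "frag_of k" c] by simp
    with k(1) ks(2) c show ?thesis by auto
  qed
  ultimately show ?thesis using assms(1) by (simp add: good_word_def)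
qed

lemma good_word_vars:
  assumes "map fst \<alpha> \<in> lists (carrier G)" "map snd \<alpha> = map frag_of ks"
    and "distinct ks" "set ks \<subseteq> {..<n}"
  shows "good_word G n \<alpha>"
  using good_word_diff[of \<alpha> G 0 ks n] assms by simp

lemma good_word_take_generic_word:
  assumes "\<sigma> \<in> lists (carrier G)"
  shows "good_word G (length \<sigma>) (take i (generic_word \<sigma>))"
  by (rule good_word_vars[where ks = "take i [0..<length \<sigma>]"])
    (use assms in \<open>auto simp: map_snd_generic_word take_map[symmetric] simp del: take_upt dest!: in_set_takeD\<close>)

lemma good_word_drop_generic_word:
  assumes "\<sigma> \<in> lists (carrier G)"
  shows "good_word G (length \<sigma>) (drop i (generic_word \<sigma>))"
  by (rule good_word_vars[where ks = "drop i [0..<length \<sigma>]"])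
    (use assms in \<open>auto simp: map_snd_generic_word drop_map[symmetric] simp del: drop_upt dest!: in_set_dropD\<close>)

lemma subst_indep_inj:
  assumes "inj f"
  shows "subst_indep n (linform_poly \<circ> (frag_of \<circ> f))"
  unfolding subst_indep_def
  by (rule exI[of _ "\<lambda>x. pvar (inv_into UNIV f x)"]) (simp add: assms)

text \<open>The linear extension of an inverse of \<open>f\<close> is a left inverse. It makes
  reindexing along renamed decompositions possible.\<close>

lemma inj_frag_extend:
  assumes "inj f"
  shows "inj (frag_extend (frag_of \<circ> f))"
proof (rule inj_on_inverseI)
  fix u show "frag_extend (frag_of \<circ> inv_into UNIV f) (frag_extend (frag_of \<circ> f) u) = u"
    using frag_expansion[of u]
    by (simp add: frag_extend_compose comp_assoc assms)
qed

section \<open>The algebra of moulds\<close>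

lemma BIMU_I:
  assumes "\<And>\<sigma>. \<sigma> \<in> lists (carrier G) \<Longrightarrow> f \<sigma> \<in> ratfuns (length \<sigma>)"
  shows "restrict f (lists (carrier G)) \<in> BIMU G"
  using assms unfolding BIMU_def by auto

lemma mould_one_in_BIMU: "mould_one G \<in> BIMU G"
  unfolding mould_one_def by (rule BIMU_I) simp

lemma mould_times_in_BIMU:
  assumes "A \<in> BIMU G" "C \<in> BIMU G"
  shows "mould_times G A C \<in> BIMU G"
  unfolding mould_times_def
  by (rule BIMU_I, intro ratfuns_sum ratfuns_mult)
    (auto intro!: mould_at_in_ratfuns assms good_word_take_generic_word good_word_drop_generic_word)

lemma mould_power_Suc: "mould_power G A (Suc k) = mould_times G A (mould_power G A k)"
  by (simp add: mould_power_def)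

lemma mould_power_0 [simp]: "mould_power G A 0 = mould_one G"
  by (simp add: mould_power_def)

lemma mould_power_in_BIMU:
  assumes "A \<in> BIMU G"
  shows "mould_power G A k \<in> BIMU G"
  by (induction k) (simp_all add: mould_power_Suc mould_one_in_BIMU mould_times_in_BIMU assms)

lemma lower_subst_eq_comp:
  "lower_subst \<alpha> = linform_poly \<circ> (\<lambda>i. if i < length \<alpha> then snd (\<alpha> ! i) else 0)"
  by (auto simp: lower_subst_def)

text \<open>The product is defined through generic words only; \<open>\<alpha>\<close> is the image
  of such a word under the substitution \<open>t\<close> of its lower entries, and \<open>t\<close>
  passes through the sum, the products and the two evaluations.\<close>

lemma mould_at_mould_times:
  assumes A: "A \<in> BIMU G" and C: "C \<in> BIMU G" and \<alpha>: "good_word G n \<alpha>"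
  shows "mould_at (mould_times G A C) \<alpha> =
    (\<Sum>i\<le>length \<alpha>. mould_at A (take i \<alpha>) * mould_at C (drop i \<alpha>))"
proof -
  define t where "t = (\<lambda>i. if i < length \<alpha> then snd (\<alpha> ! i) else 0)"
  define \<sigma> where "\<sigma> = map fst \<alpha>"
  have \<sigma>: "\<sigma> \<in> lists (carrier G)" using \<alpha> by (simp add: good_word_def \<sigma>_def)
  have len: "length \<sigma> = length \<alpha>" by (simp add: \<sigma>_def)
  have indep: "subst_indep (length \<alpha>) (linform_poly \<circ> t)"
    using \<alpha> by (simp add: good_word_def t_def flip: lower_subst_eq_comp)
  have \<alpha>_eq: "word_map t (generic_word \<sigma>) = \<alpha>"
    unfolding t_def \<sigma>_def by (rule word_map_generic_word)
  have tk: "word_map t (take i (generic_word \<sigma>)) = take i \<alpha>"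
    and dr: "word_map t (drop i (generic_word \<sigma>)) = drop i \<alpha>" for i
    by (simp_all add: word_map_def take_map drop_map flip: \<alpha>_eq)
  note gt = good_word_take_generic_word[OF \<sigma>, unfolded len]
  note gd = good_word_drop_generic_word[OF \<sigma>, unfolded len]
  have "mould_at (mould_times G A C) \<alpha> = ratfun_subst (linform_poly \<circ> t) (\<Sum>i\<le>length \<alpha>.
      mould_at A (take i (generic_word \<sigma>)) * mould_at C (drop i (generic_word \<sigma>)))"
    unfolding mould_at_eq[of _ \<alpha>] lower_subst_eq_comp t_def[symmetric] \<sigma>_def[symmetric]
    using \<sigma> by (simp add: mould_times_def len)
  also have "\<dots> = (\<Sum>i\<le>length \<alpha>. mould_at A (take i \<alpha>) * mould_at C (drop i \<alpha>))"
    by (simp add: ratfun_subst_sum[OF indep] ratfun_subst_mult[OF indep] ratfuns_mult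
        mould_at_in_ratfuns[OF A gt] mould_at_in_ratfuns[OF C gd]
        ratfun_subst_mould_at[OF A gt indep] ratfun_subst_mould_at[OF C gd indep] tk dr)
  finally show ?thesis .
qed

text \<open>As A vanishes at the empty word, each factor uses up at least one letter: the term with
  \<open>i = 0\<close> contains A at the empty word, and every other term leaves fewer than
  \<open>k\<close> letters to the k-th power.\<close>

lemma mould_power_eq_0:
  assumes A: "A \<in> ARI G" and "\<sigma> \<in> lists (carrier G)" "length \<sigma> < k"
  shows "mould_power G A k \<sigma> = 0"
  using assms(2,3)
proof (induction k arbitrary: \<sigma>)
  case (Suc k)
  have A': "A \<in> BIMU G" "A [] = 0" using A by (auto simp: ARI_def)
  have "mould_at A (take i (generic_word \<sigma>)) * mould_at (mould_power G A k) (drop i (generic_word \<sigma>)) = 0"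
    if "i \<le> length \<sigma>" for i
  proof (cases "i = 0")
    case True
    then show ?thesis by (simp add: mould_at_Nil[OF A'(1)] A'(2))
  next
    case False
    with that Suc.prems(2) have "length (drop i \<sigma>) < k" unfolding length_drop by linarith
    with Suc.prems have "mould_power G A k (drop i \<sigma>) = 0"
      by (intro Suc.IH) (auto dest: in_set_dropD)
    then show ?thesis by (simp add: mould_at_eq flip: drop_map)
  qed
  then show ?case
    unfolding mould_power_Suc mould_times_def restrict_apply'[OF Suc.prems(1)]
    by (intro sum.neutral) blast
qed simp

text \<open>The upper limit \<open>N\<close> is left free so that words of different lengths can
  share one range of summation.\<close>

lemma exp_times_eq_sum:
  assumes A: "A \<in> ARI G" and "\<sigma> \<in> lists (carrier G)" "length \<sigma> \<le> N"
  shows "exp_times G A \<sigma> = (\<Sum>k\<le>N. ratfun_const (1 / fact k) * mould_power G A k \<sigma>)"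
proof -
  have "{k. ratfun_const (1 / fact k) * mould_power G A k \<sigma> \<noteq> 0} \<subseteq> {..N}"
    using mould_power_eq_0[OF A assms(2)] assms(3) by (force simp: not_le[symmetric])
  then show ?thesis
    using assms(2) by (simp add: exp_times_def Sum_any.expand_superset[of "{..N}"])
qed

lemma exp_times_in_BIMU:
  assumes "A \<in> ARI G"
  shows "exp_times G A \<in> BIMU G"
proof -
  have A: "A \<in> BIMU G" using assms by (simp add: ARI_def)
  have "exp_times G A = restrict (exp_times G A) (lists (carrier G))"
    by (simp add: exp_times_def)
  also have "\<dots> \<in> BIMU G"
  proof (rule BIMU_I)
    fix \<sigma> :: "'a list" assume \<sigma>: "\<sigma> \<in> lists (carrier G)"
    show "exp_times G A \<sigma> \<in> ratfuns (length \<sigma>)"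
      unfolding exp_times_eq_sum[OF assms \<sigma> order_refl]
      by (intro ratfuns_sum ratfuns_mult ratfuns_const BIMU_D[OF mould_power_in_BIMU[OF A] \<sigma>])
  qed
  finally show ?thesis .
qed

lemma mould_at_exp_times:
  assumes A: "A \<in> ARI G" and \<alpha>: "good_word G n \<alpha>" "length \<alpha> \<le> N"
  shows "mould_at (exp_times G A) \<alpha> =
    (\<Sum>k\<le>N. ratfun_const (1 / fact k) * mould_at (mould_power G A k) \<alpha>)"
proof -
  have A': "A \<in> BIMU G" using A by (simp add: ARI_def)
  have \<sigma>: "map fst \<alpha> \<in> lists (carrier G)" and indep: "subst_indep (length \<alpha>) (lower_subst \<alpha>)"
    using \<alpha> by (simp_all add: good_word_def)
  show ?thesis
    unfolding mould_at_eq using \<alpha>(2)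
    by (simp add: exp_times_eq_sum[OF A \<sigma>, of N] ratfun_subst_sum[OF indep]
        ratfun_subst_mult[OF indep] ratfuns_mult good_word_BIMU[OF \<alpha>(1) mould_power_in_BIMU[OF A']])
qed

section \<open>Decompositions of words\<close>

abbreviation decomp_word :: "('a list \<times> 'a list) list \<Rightarrow> 'a list" where
  "decomp_word d \<equiv> concat (map (\<lambda>(a, b). a @ b) d)"

text \<open>Only the parts \<open>a\<close> count: this is the length of the word of upper flexions,
  hence the range of its cuts.\<close>

abbreviation decomp_size :: "('a list \<times> 'a list) list \<Rightarrow> nat" where
  "decomp_size d \<equiv> length (concat (map fst d))"

text \<open>Recursive form of the conditions on blocks: that only the last \<open>b\<close> may be
  empty becomes the rule that an empty \<open>b\<close> ends the list.\<close>

fun valid_decomp :: "('a list \<times> 'a list) list \<Rightarrow> bool" where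
  "valid_decomp [] \<longleftrightarrow> True"
| "valid_decomp ((a, b) # d) \<longleftrightarrow> a \<noteq> [] \<and> (b = [] \<longrightarrow> d = []) \<and> valid_decomp d"

text \<open>Differs from \<^const>\<open>ganit_decomps\<close> only at the empty word, which here has the empty
  decomposition.\<close>

definition decomps :: "'a list \<Rightarrow> ('a list \<times> 'a list) list set" where
  "decomps w = {d. valid_decomp d \<and> decomp_word d = w}"

lemma valid_decomp_iff:
  "valid_decomp d \<longleftrightarrow> (\<forall>(a, b)\<in>set d. a \<noteq> []) \<and> (\<forall>(a, b)\<in>set (butlast d). b \<noteq> [])"
  by (induction d rule: valid_decomp.induct) auto

lemma ganit_decomps_eq: "w \<noteq> [] \<Longrightarrow> ganit_decomps w = decomps w"
  unfolding ganit_decomps_def decomps_def valid_decomp_iff by auto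

lemma decomp_word_Nil_iff: "valid_decomp d \<Longrightarrow> decomp_word d = [] \<longleftrightarrow> d = []"
  by (cases d rule: valid_decomp.cases) auto

lemma decomps_Nil: "decomps [] = {[]}"
  unfolding decomps_def using decomp_word_Nil_iff by auto

lemma decomp_size_le:
  assumes "d \<in> decomps (generic_word \<sigma>)"
  shows "decomp_size d \<le> length \<sigma>"
proof -
  have "decomp_size d \<le> length (decomp_word d)"
    by (induction d) auto
  then show ?thesis using assms by (simp add: decomps_def)
qed

lemma finite_decomps: "finite (decomps w)"
  for w :: "'g word"
proof (cases "w = []")
  case False
  then show ?thesis using finite_ganit_decomps[of w] by (simp add: ganit_decomps_eq)
qed (simp add: decomps_Nil)

text \<open>Concatenation, except that a final block with empty \<open>b\<close> would be illegal in
  the middle and is fused with the first block of \<open>e\<close>. The tail \<open>d\<close>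
  dropped in that branch is empty for valid input.\<close>

fun join_decomp :: "('a list \<times> 'a list) list \<Rightarrow> ('a list \<times> 'a list) list \<Rightarrow> ('a list \<times> 'a list) list"
  where
  "join_decomp [] e = e"
| "join_decomp ((a, b) # d) e =
     (if b = [] then (case e of [] \<Rightarrow> [(a, [])] | (a', b') # e' \<Rightarrow> (a @ a', b') # e')
      else (a, b) # join_decomp d e)"

text \<open>Here \<open>j\<close> counts letters of the parts \<open>a\<close> only. The tests
  \<open>j = 0\<close> and \<open>j < length a\<close> ensure that a block which is cut leaves a
  nonempty \<open>a\<close> on either side.\<close>

fun split_decomp :: "nat \<Rightarrow> ('a list \<times> 'a list) list \<Rightarrow>
    ('a list \<times> 'a list) list \<times> ('a list \<times> 'a list) list" where
  "split_decomp j [] = ([], [])"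
| "split_decomp j ((a, b) # d) =
     (if j = 0 then ([], (a, b) # d)
      else if j < length a then ([(take j a, [])], (drop j a, b) # d)
      else apfst ((#) (a, b)) (split_decomp (j - length a) d))"

lemma split_decomp_0 [simp]: "split_decomp 0 d = ([], d)"
  by (cases d rule: valid_decomp.cases) auto

lemma join_split_decomp:
  assumes "valid_decomp d"
  shows "join_decomp (fst (split_decomp j d)) (snd (split_decomp j d)) = d"
  using assms by (induction j d rule: split_decomp.induct) auto

lemma decomp_word_split:
  "decomp_word (fst (split_decomp j d)) @ decomp_word (snd (split_decomp j d)) = decomp_word d"
  by (induction j d rule: split_decomp.induct) auto

lemma split_decomp_Nil_iff:
  assumes "valid_decomp d"
  shows "fst (split_decomp j d) = [] \<longleftrightarrow> j = 0 \<or> d = []"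
  using assms by (cases d rule: valid_decomp.cases) auto

lemma valid_split_decomp:
  assumes "valid_decomp d"
  shows "valid_decomp (fst (split_decomp j d)) \<and> valid_decomp (snd (split_decomp j d))"
  using assms by (induction j d rule: split_decomp.induct) (auto simp: split_decomp_Nil_iff)

text \<open>Beyond the bound on \<open>j\<close> the whole of \<open>d\<close> goes to the left and
  the size stops growing.\<close>

lemma decomp_size_split:
  assumes "valid_decomp d" "j \<le> decomp_size d"
  shows "decomp_size (fst (split_decomp j d)) = j"
  using assms by (induction j d rule: split_decomp.induct) auto

lemma valid_join_decomp:
  assumes "valid_decomp d" "valid_decomp e"
  shows "valid_decomp (join_decomp d e)"
  using assms
  by (induction d e rule: join_decomp.induct) (auto split: list.splits)

lemma decomp_word_join:
  assumes "valid_decomp d"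
  shows "decomp_word (join_decomp d e) = decomp_word d @ decomp_word e"
  using assms by (induction d e rule: join_decomp.induct) (auto split: list.splits)

lemma decomp_size_join:
  assumes "valid_decomp d"
  shows "decomp_size (join_decomp d e) = decomp_size d + decomp_size e"
  using assms by (induction d e rule: join_decomp.induct) (auto split: list.splits)

text \<open>If the last \<open>b\<close> of \<open>d\<close> is nonempty, the recursion stops
  exactly at the seam. If it is empty, the first block \<open>(a', b')\<close> of a nonempty
  \<open>e\<close> was fused with \<open>a\<close>; validity of \<open>e\<close> gives a nonempty
  \<open>a'\<close>, so the cut falls strictly inside \<open>a @ a'\<close> and undoes the
  fusion.\<close>

lemma split_join_decomp:
  assumes "valid_decomp d" "valid_decomp e"
  shows "split_decomp (decomp_size d) (join_decomp d e) = (d, e)"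
  using assms by (induction d e rule: join_decomp.induct) (auto split: list.splits)

text \<open>A cut of the evaluated word inside a block \<open>a\<^sub>i\<close> becomes a last block with empty \<open>b\<close>,
  a cut between two blocks keeps the nonempty \<open>b\<^sub>i\<close> to its left.\<close>

lemma sum_decomps_cut:
  fixes w :: "'g word"
  shows "(\<Sum>i\<le>length w. \<Sum>d\<in>decomps (take i w). \<Sum>e\<in>decomps (drop i w). F d e) =
   (\<Sum>d\<in>decomps w. \<Sum>j\<le>decomp_size d. F (fst (split_decomp j d)) (snd (split_decomp j d)))"
proof -
  let ?L = "SIGMA i:{..length w}. decomps (take i w) \<times> decomps (drop i w)"
  let ?R = "SIGMA d:decomps w. {..decomp_size d}"
  have "(\<Sum>i\<le>length w. \<Sum>d\<in>decomps (take i w). \<Sum>e\<in>decomps (drop i w). F d e) =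
      (\<Sum>(i, d, e)\<in>?L. F d e)"
    by (simp add: sum.Sigma finite_decomps sum.cartesian_product)
  also have "\<dots> = (\<Sum>(d, j)\<in>?R. F (fst (split_decomp j d)) (snd (split_decomp j d)))"
  proof (rule sum.reindex_bij_witness)
    \<comment> \<open>The cut position in \<open>w\<close> is the length of the text covered by the
      left half; it differs from \<open>j\<close> because it also counts the letters of the parts
      \<open>b\<close>.\<close>
    let ?i = "\<lambda>(d, j). (length (decomp_word (fst (split_decomp j d))), split_decomp j d)"
    let ?j = "\<lambda>(i :: nat, d, e). (join_decomp d e, decomp_size d)"
    show "?i (?j x) = x" if "x \<in> ?L" for x
      using that by (auto simp: decomps_def split_join_decomp)
    show "?j x \<in> ?R" if "x \<in> ?L" for x
      using that
      by (auto simp: decomps_def valid_join_decomp decomp_word_join decomp_size_join)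
    show "?j (?i x) = x" if "x \<in> ?R" for x
      using that
      by (auto simp: decomps_def join_split_decomp decomp_size_split case_prod_beta)
    show "?i x \<in> ?L" if "x \<in> ?R" for x
    proof -
      from that obtain d j where x: "x = (d, j)" "d \<in> decomps w" by (elim SigmaE)
      obtain d1 d2 where d12: "split_decomp j d = (d1, d2)" by fastforce
      have "decomp_word d1 @ decomp_word d2 = w" "valid_decomp d1" "valid_decomp d2"
        using decomp_word_split[of j d] valid_split_decomp[of d j] x(2) d12
        by (auto simp: decomps_def)
      then have "length (decomp_word d1) \<le> length w"
        "decomp_word d1 = take (length (decomp_word d1)) w"
        "decomp_word d2 = drop (length (decomp_word d1)) w"
        "valid_decomp d1" "valid_decomp d2" by auto
      then show ?thesis
        unfolding x(1) case_prod_conv d12 fst_conv decomps_def mem_Sigma_iff atMost_iff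
          mem_Collect_eq by blast
    qed
    show "(case ?j x of (d, j) \<Rightarrow> F (fst (split_decomp j d)) (snd (split_decomp j d))) =
        (case x of (i, d, e) \<Rightarrow> F d e)" if "x \<in> ?L" for x
      using that by (auto simp: decomps_def split_join_decomp)
  qed
  also have "\<dots> = (\<Sum>d\<in>decomps w. \<Sum>j\<le>decomp_size d.
      F (fst (split_decomp j d)) (snd (split_decomp j d)))"
    by (simp add: sum.Sigma finite_decomps)
  finally show ?thesis .
qed

section \<open>Decompositions under letterwise maps\<close>

lemma valid_decomp_map [simp]:
  "valid_decomp (map (map_prod (map f) (map f)) d) \<longleftrightarrow> valid_decomp d"
  by (induction d rule: valid_decomp.induct) auto

lemma decomp_word_map [simp]:
  "decomp_word (map (map_prod (map f) (map f)) d) = map f (decomp_word d)"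
  by (induction d) auto

lemma map_eq_append3E:
  assumes "map f w = a @ b @ c"
  obtains a' b' c' where "w = a' @ b' @ c'" "a = map f a'" "b = map f b'" "c = map f c'"
proof -
  obtain a' v where v: "w = a' @ v" "a = map f a'" "map f v = b @ c"
    using assms unfolding map_eq_append_conv[of f w] by metis
  obtain b' c' where "v = b' @ c'" "b = map f b'" "c = map f c'"
    using v(3) unfolding map_eq_append_conv[of f v] by metis
  with v(1,2) show ?thesis by (intro that) simp_all
qed

text \<open>A decomposition only records where a word is cut, so the cuts of the image can be pulled
  back to \<open>w\<close> block by block.\<close>

lemma decomps_map: "decomps (map f w) = map (map_prod (map f) (map f)) ` decomps w"
proof (rule equalityI; rule subsetI)
  have *: "\<exists>d. valid_decomp d \<and> decomp_word d = w \<and> e = map (map_prod (map f) (map f)) d"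
    if "valid_decomp e" "decomp_word e = map f w" for e w
    using that
  proof (induction e arbitrary: w)
    case (Cons x e)
    obtain a b where x: "x = (a, b)" by fastforce
    have v: "a \<noteq> []" "b = [] \<Longrightarrow> e = []" "valid_decomp e"
      using Cons.prems(1) by (auto simp: x)
    from Cons.prems(2) have "map f w = a @ b @ decomp_word e" by (simp add: x)
    then obtain a' b' w' where w: "w = a' @ b' @ w'" "a = map f a'" "b = map f b'"
      "decomp_word e = map f w'"
      by (rule map_eq_append3E)
    from Cons.IH[OF v(3) w(4)] obtain d where
      d: "valid_decomp d" "decomp_word d = w'" "e = map (map_prod (map f) (map f)) d" by metis
    have "valid_decomp ((a', b') # d)" using v w(2,3) d by simp
    moreover have "decomp_word ((a', b') # d) = w" using w(1) d(2) by simp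
    ultimately show ?case
      using w(2,3) d(3) by (intro exI[of _ "(a', b') # d"]) (simp add: x)
  qed simp
  show "e \<in> map (map_prod (map f) (map f)) ` decomps w" if "e \<in> decomps (map f w)" for e
    using *[of e w] that unfolding decomps_def by blast
  show "e \<in> decomps (map f w)" if "e \<in> map (map_prod (map f) (map f)) ` decomps w" for e
  proof -
    from that obtain d where "valid_decomp d" "decomp_word d = w"
      "e = map (map_prod (map f) (map f)) d"
      unfolding decomps_def by blast
    then show ?thesis
      unfolding decomps_def mem_Collect_eq by (simp only: valid_decomp_map decomp_word_map)
  qed
qed

section \<open>Multiplicativity of ganit\<close>

abbreviation ganit_coeff :: "'g mould \<Rightarrow> ('g word \<times> 'g word) list \<Rightarrow> ratfun" where
  "ganit_coeff B d \<equiv> (\<Prod>(a, b)\<leftarrow>d. mould_at B (flex_lower a b))"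

abbreviation ganit_word ::
  "('g, 'b) monoid_scheme \<Rightarrow> ('g word \<times> 'g word) list \<Rightarrow> 'g word" where
  "ganit_word G d \<equiv> concat (map (\<lambda>(a, b). flex_upper G a b) d)"

lemma map_snd_flex_upper: "map snd (flex_upper G a b) = map snd a"
proof (cases "a = []")
  case False
  then have "map snd (butlast a) @ [snd (last a)] = map snd a"
    by (metis append_butlast_last_id list.simps(8,9) map_append)
  then show ?thesis by (simp add: flex_upper_def)
qed (simp add: flex_upper_def)

lemma length_flex_upper [simp]: "length (flex_upper G a b) = length a"
  using arg_cong[OF map_snd_flex_upper[of G a b], of length] by simp

lemma length_ganit_word: "length (ganit_word G d) = decomp_size d"
  by (induction d) auto

lemma flex_upper_append:
  "a' \<noteq> [] \<Longrightarrow> flex_upper G (a @ a') b = a @ flex_upper G a' b"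
  by (auto simp: flex_upper_def butlast_append)

lemma flex_lower_append: "a' \<noteq> [] \<Longrightarrow> flex_lower (a @ a') b = flex_lower a' b"
  by (simp add: flex_lower_def)

lemma flex_lower_Nil [simp]: "flex_lower a [] = []"
  by (simp add: flex_lower_def)

lemma flex_upper_Nil [simp]: "flex_upper G a [] = a"
  by (simp add: flex_upper_def)

lemma ganit_word_join:
  assumes "valid_decomp d" "valid_decomp e"
  shows "ganit_word G (join_decomp d e) = ganit_word G d @ ganit_word G e"
  using assms
  by (induction d e rule: join_decomp.induct) (auto simp: flex_upper_append split: list.splits)

lemma ganit_coeff_join:
  assumes "valid_decomp d" "valid_decomp e" "mould_at B [] = 1"
  shows "ganit_coeff B (join_decomp d e) = ganit_coeff B d * ganit_coeff B e"
  using assms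
  by (induction d e rule: join_decomp.induct)
    (auto simp: flex_lower_append mult.assoc split: list.splits)

section \<open>Admissibility of the words produced by the flexions\<close>

lemma map_fst_flex_upper:
  assumes "group G" "map fst a \<in> lists (carrier G)" "map fst b \<in> lists (carrier G)"
  shows "map fst (flex_upper G a b) \<in> lists (carrier G)"
proof -
  interpret group G by fact
  have fold: "foldl (\<otimes>\<^bsub>G\<^esub>) x xs \<in> carrier G" if "x \<in> carrier G" "set xs \<subseteq> carrier G" for x xs
    using that by (induction xs arbitrary: x) auto
  have "set (map fst a) \<subseteq> carrier G" "set (map fst b) \<subseteq> carrier G"
    using assms(2,3) unfolding in_lists_conv_set by blast+
  moreover from this have "foldl (\<otimes>\<^bsub>G\<^esub>) (fst (last a)) (map fst b) \<in> carrier G" if "a \<noteq> []"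
    using that by (intro fold) auto
  moreover have "set (map fst (butlast a)) \<subseteq> set (map fst a)"
    by (auto dest: in_set_butlastD)
  ultimately have "set (map fst (flex_upper G a b)) \<subseteq> carrier G"
    unfolding flex_upper_def by (simp split: if_split) blast
  then show ?thesis by (simp only: in_lists_conv_set subset_iff) blast
qed

lemma map_fst_ganit_word:
  assumes "group G" "map fst (decomp_word d) \<in> lists (carrier G)"
  shows "map fst (ganit_word G d) \<in> lists (carrier G)"
  using assms(2)
proof (induction d)
  case (Cons x d)
  obtain a b where x: "x = (a, b)" by fastforce
  have "map fst (flex_upper G a b) \<in> lists (carrier G)"
    by (rule map_fst_flex_upper[OF assms(1)]) (use Cons.prems x in auto)
  moreover have "map fst (ganit_word G d) \<in> lists (carrier G)"
    by (rule Cons.IH) (use Cons.prems in auto)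
  ultimately show ?case by (simp add: x)
qed simp

text \<open>What survives of the lower entries are those of the parts \<open>a\<close>, in their
  order, hence still distinct variables.\<close>

lemma map_snd_ganit_word:
  assumes "map snd (decomp_word d) = map frag_of ks" "distinct ks"
  shows "\<exists>ks'. map snd (ganit_word G d) = map frag_of ks' \<and> distinct ks' \<and> set ks' \<subseteq> set ks"
  using assms
proof (induction d arbitrary: ks)
  case (Cons x d)
  obtain a b where x: "x = (a, b)" by fastforce
  from Cons.prems(1) have "map frag_of ks = map snd a @ map snd b @ map snd (decomp_word d)"
    by (simp add: x)
  then obtain k1 k2 k3 where ks: "ks = k1 @ k2 @ k3" "map snd a = map frag_of k1"
    "map snd (decomp_word d) = map frag_of k3"
    by (rule map_eq_append3E)
  obtain ks' where ks': "map snd (ganit_word G d) = map frag_of ks'" "distinct ks'"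
    "set ks' \<subseteq> set k3"
    using Cons.IH[OF ks(3)] Cons.prems(2) ks(1) by auto
  show ?case
    by (rule exI[of _ "k1 @ ks'"])
      (use ks ks' Cons.prems(2) in \<open>auto simp: x map_snd_flex_upper\<close>)
qed simp

lemma good_word_ganit_word:
  assumes "group G" "\<sigma> \<in> lists (carrier G)" "d \<in> decomps (generic_word \<sigma>)"
  shows "good_word G (length \<sigma>) (ganit_word G d)"
proof -
  have d: "decomp_word d = generic_word \<sigma>" using assms(3) by (simp add: decomps_def)
  obtain ks where "map snd (ganit_word G d) = map frag_of ks" "distinct ks"
    "set ks \<subseteq> set [0..<length \<sigma>]"
    using map_snd_ganit_word[of d "[0..<length \<sigma>]"] d by (auto simp: map_snd_generic_word)
  moreover have "map fst (ganit_word G d) \<in> lists (carrier G)"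
    by (rule map_fst_ganit_word[OF assms(1)]) (use assms(2) d in simp)
  ultimately show ?thesis by (intro good_word_vars[where ks = ks]) auto
qed

text \<open>The lower entries are differences of a variable of \<open>b\<close> and the variable of
  the last letter of \<open>a\<close>. The latter stands before \<open>b\<close> in the word and so
  does not occur in it, which is the nonzero case of \<open>good_word_diff\<close>.\<close>

lemma good_word_flex_lower:
  assumes "\<sigma> \<in> lists (carrier G)" "d \<in> decomps (generic_word \<sigma>)" "(a, b) \<in> set d"
  shows "good_word G (length \<sigma>) (flex_lower a b)"
proof -
  have d: "decomp_word d = generic_word \<sigma>" "a \<noteq> []"
    using assms(2,3) by (auto simp: decomps_def valid_decomp_iff)
  obtain d1 d2 where "d = d1 @ (a, b) # d2" using assms(3) by (meson split_list)
  with d(1) have w: "generic_word \<sigma> = decomp_word d1 @ a @ b @ decomp_word d2" by simp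
  have "map frag_of [0..<length \<sigma>] =
      map snd (decomp_word d1) @ map snd a @ map snd b @ map snd (decomp_word d2)"
    using arg_cong[OF w, of "map snd"] by (simp add: map_snd_generic_word)
  then obtain k1 k2 v where v: "[0..<length \<sigma>] = k1 @ k2 @ v" "map snd a = map frag_of k2"
    "map snd b @ map snd (decomp_word d2) = map frag_of v"
    by (rule map_eq_append3E)
  obtain k3 k4 where k34: "v = k3 @ k4" "map snd b = map frag_of k3"
    using v(3)[symmetric] unfolding map_eq_append_conv[of frag_of v] by metis
  have ks: "[0..<length \<sigma>] = k1 @ k2 @ k3 @ k4"
    "map snd a = map frag_of k2" "map snd b = map frag_of k3"
    using v(1,2) k34 by simp_all
  have dist: "distinct (k1 @ k2 @ k3 @ k4)" and sub: "set (k1 @ k2 @ k3 @ k4) = {..<length \<sigma>}"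
    unfolding ks(1)[symmetric] by auto
  have k2: "k2 \<noteq> []" using ks(2) d(2) by auto
  then have mem: "last k2 \<in> set k2" by simp
  have "snd (last a) = last (map snd a)" using d(2) by (simp add: last_map)
  also have "\<dots> = frag_of (last k2)" using k2 by (simp add: ks(2) last_map)
  finally have la: "snd (last a) = frag_of (last k2)" .
  show ?thesis
  proof (rule good_word_diff[where ks = k3])
    have "set (map fst b) \<subseteq> set (map fst (generic_word \<sigma>))" unfolding w by auto
    moreover have "map fst (flex_lower a b) = map fst b"
      by (simp add: flex_lower_def case_prod_beta)
    ultimately show "map fst (flex_lower a b) \<in> lists (carrier G)"
      using assms(1) unfolding map_fst_generic_word in_lists_conv_set by auto
    have "map snd (flex_lower a b) = map (\<lambda>z. z - snd (last a)) (map snd b)"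
      by (simp add: flex_lower_def case_prod_beta)
    then show "map snd (flex_lower a b) = map (\<lambda>k. frag_of k - frag_of (last k2)) k3"
      by (simp add: ks(3) la)
    show "distinct k3" "set k3 \<subseteq> {..<length \<sigma>}" using dist sub by auto
    show "frag_of (last k2) = 0 \<or>
        (\<exists>y<length \<sigma>. y \<notin> set k3 \<and> frag_of (last k2) = frag_of y)"
      using dist sub mem by auto
  qed
qed

section \<open>Compatibility of the flexions with linear changes of variables\<close>

lemma flex_lower_word_map:
  assumes "a \<noteq> []"
  shows "flex_lower (word_map t a) (word_map t b) = word_map t (flex_lower a b)"
  \<comment> \<open>Linearity of \<open>frag_extend t\<close> gives the claim; \<open>a\<close> must
    be nonempty because \<open>last []\<close> is unspecified and need not commute with
    \<open>word_map t\<close>.\<close>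
  using assms by (auto simp: flex_lower_def word_map_def last_map frag_extend_diff)

lemma flex_upper_word_map:
  "flex_upper G (word_map t a) (word_map t b) = word_map t (flex_upper G a b)"
proof -
  have "map (fst \<circ> apsnd (frag_extend t)) b = map fst b" by simp
  then show ?thesis
    by (simp only: flex_upper_def word_map_def map_map) (simp add: last_map map_butlast)
qed

lemma ganit_word_word_map:
  "ganit_word G (map (map_prod (word_map t) (word_map t)) d) = word_map t (ganit_word G d)"
  by (induction d) (auto simp: flex_upper_word_map, simp add: word_map_def)

lemma ganit_coeff_word_map:
  assumes "B \<in> BIMU G" "\<sigma> \<in> lists (carrier G)" "d \<in> decomps (generic_word \<sigma>)"
    and indep: "subst_indep (length \<sigma>) (linform_poly \<circ> t)"
  shows "ganit_coeff B (map (map_prod (word_map t) (word_map t)) d) =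
    ratfun_subst (linform_poly \<circ> t) (ganit_coeff B d)"
    and "ganit_coeff B d \<in> ratfuns (length \<sigma>)"
proof -
  have good: "good_word G (length \<sigma>) (flex_lower a b)" if "(a, b) \<in> set d" for a b
    by (rule good_word_flex_lower[OF assms(2,3) that])
  have mem: "x \<in> ratfuns (length \<sigma>)"
    if "x \<in> set (map (\<lambda>(a, b). mould_at B (flex_lower a b)) d)" for x
    using that mould_at_in_ratfuns[OF assms(1) good] by auto
  then show "ganit_coeff B d \<in> ratfuns (length \<sigma>)" by (rule ratfuns_prod_list)
  have ne: "a \<noteq> []" if "(a, b) \<in> set d" for a b
    using assms(3) that by (auto simp: decomps_def valid_decomp_iff)
  have "map (\<lambda>(a, b). mould_at B (flex_lower a b)) (map (map_prod (word_map t) (word_map t)) d) =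
      map (ratfun_subst (linform_poly \<circ> t)) (map (\<lambda>(a, b). mould_at B (flex_lower a b)) d)"
    by (auto simp: flex_lower_word_map ne ratfun_subst_mould_at[OF assms(1) good indep])
  then show "ganit_coeff B (map (map_prod (word_map t) (word_map t)) d) =
      ratfun_subst (linform_poly \<circ> t) (ganit_coeff B d)"
    by (simp only: ratfun_subst_prod_list[OF indep mem])
qed

text \<open>Absorbs the separate clause for the empty word: its only decomposition is empty, with
  coefficient an empty product and with an empty word to evaluate at.\<close>

lemma ganit_eq_sum:
  assumes "A \<in> BIMU G" "\<sigma> \<in> lists (carrier G)"
  shows "ganit G B A \<sigma> =
    (\<Sum>d\<in>decomps (generic_word \<sigma>). ganit_coeff B d * mould_at A (ganit_word G d))"
proof (cases "\<sigma> = []")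
  case True
  then show ?thesis by (simp add: ganit_def decomps_Nil mould_at_Nil[OF assms(1)])
next
  case False
  then have "generic_word \<sigma> \<noteq> []" using length_generic_word[of \<sigma>] by fastforce
  with False show ?thesis using assms(2) by (simp add: ganit_def ganit_decomps_eq)
qed

text \<open>Supplies the values of \<open>ganit\<close> at the two halves of a cut generic word,
  which are renamings of shorter generic words. Decompositions, coefficients and evaluation words
  are all carried along by the renaming.\<close>

lemma mould_at_ganit:
  fixes f :: "nat \<Rightarrow> nat"
  assumes "group G" "B \<in> BIMU G" "A \<in> BIMU G" "\<sigma> \<in> lists (carrier G)" "inj f"
  defines "\<alpha> \<equiv> word_map (frag_of \<circ> f) (generic_word \<sigma>)"
  shows "mould_at (ganit G B A) \<alpha> =
    (\<Sum>d\<in>decomps \<alpha>. ganit_coeff B d * mould_at A (ganit_word G d))"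
proof -
  let ?t = "frag_of \<circ> f"
  let ?m = "map (map_prod (word_map ?t) (word_map ?t))"
  let ?D = "decomps (generic_word \<sigma>)"
  have indep: "subst_indep n (linform_poly \<circ> ?t)" for n by (rule subst_indep_inj[OF assms(5)])
  have wm: "word_map ?t = map (apsnd (frag_extend ?t))" by (auto simp: word_map_def)
  have "inj (apsnd (frag_extend ?t) :: 'a \<times> linform \<Rightarrow> _)"
    using inj_frag_extend[OF assms(5)] by (auto simp: inj_def)
  then have "inj (word_map ?t :: 'a word \<Rightarrow> _)" unfolding wm by simp
  then have "inj (?m :: ('a word \<times> 'a word) list \<Rightarrow> _)" by (simp add: prod.inj_map)
  \<comment> \<open>Distinct decompositions stay distinct after renaming, so the final reindexing
    neither merges nor loses terms.\<close>
  then have inj: "inj_on ?m ?D" by (rule inj_on_subset) simp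
  have dec: "decomps \<alpha> = ?m ` ?D" unfolding \<alpha>_def wm by (rule decomps_map)
  note co = ganit_coeff_word_map[OF assms(2,4) _ indep]
  note gw = good_word_ganit_word[OF assms(1,4)]
  have fst: "map fst \<alpha> = \<sigma>" by (simp add: \<alpha>_def)
  have lower: "ratfun_subst (lower_subst \<alpha>) f = ratfun_subst (linform_poly \<circ> ?t) f"
    if f: "f \<in> ratfuns (length \<sigma>)" for f
  proof (rule ratfun_subst_cong[OF f indep])
    show "lower_subst \<alpha> i = (linform_poly \<circ> ?t) i" if "i < length \<sigma>" for i
      using that by (simp add: lower_subst_def \<alpha>_def word_map_def nth_generic_word)
  qed
  have mem: "ganit_coeff B d * mould_at A (ganit_word G d) \<in> ratfuns (length \<sigma>)"
    if "d \<in> ?D" for d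
    by (intro ratfuns_mult co(2) mould_at_in_ratfuns[OF assms(3) gw] that)
  have "mould_at (ganit G B A) \<alpha> = ratfun_subst (linform_poly \<circ> ?t)
      (\<Sum>d\<in>?D. ganit_coeff B d * mould_at A (ganit_word G d))"
    unfolding mould_at_eq[of _ \<alpha>] fst ganit_eq_sum[OF assms(3,4)]
    by (rule lower[OF ratfuns_sum[OF mem]])
  also have "\<dots> = (\<Sum>d\<in>?D. ratfun_subst (linform_poly \<circ> ?t) (ganit_coeff B d) *
      ratfun_subst (linform_poly \<circ> ?t) (mould_at A (ganit_word G d)))"
    by (subst ratfun_subst_sum[OF indep mem]; (intro sum.cong refl)?)
      (simp_all only: ratfun_subst_mult[OF indep co(2) mould_at_in_ratfuns[OF assms(3) gw]])
  also have "\<dots> = (\<Sum>d\<in>?D. ganit_coeff B (?m d) * mould_at A (ganit_word G (?m d)))"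
    by (intro sum.cong refl)
      (simp only: co(1) ganit_word_word_map ratfun_subst_mould_at[OF assms(3) gw indep])
  also have "\<dots> = (\<Sum>d\<in>decomps \<alpha>. ganit_coeff B d * mould_at A (ganit_word G d))"
    by (rule sum.reindex_cong[OF inj dec refl, symmetric])
  finally show ?thesis .
qed

lemma ganit_mould_times:
  assumes "group G" "B \<in> GARI G" "A \<in> BIMU G" "C \<in> BIMU G"
  shows "ganit G B (mould_times G A C) = mould_times G (ganit G B A) (ganit G B C)"
proof
  fix \<sigma> :: "'a list"
  have B: "B \<in> BIMU G" "B [] = 1" using assms(2) by (auto simp: GARI_def)
  have B1: "mould_at B [] = 1" by (simp add: mould_at_Nil[OF B(1)] B(2))
  show "ganit G B (mould_times G A C) \<sigma> = mould_times G (ganit G B A) (ganit G B C) \<sigma>"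
  proof (cases "\<sigma> \<in> lists (carrier G)")
    case \<sigma>: True
    let ?w = "generic_word \<sigma>"
    have tk: "take i \<sigma> \<in> lists (carrier G)" and dr: "drop i \<sigma> \<in> lists (carrier G)" for i
      using \<sigma> by (auto dest: in_set_takeD in_set_dropD)
    have "ganit G B (mould_times G A C) \<sigma> =
        (\<Sum>d\<in>decomps ?w. ganit_coeff B d * mould_at (mould_times G A C) (ganit_word G d))"
      by (rule ganit_eq_sum[OF mould_times_in_BIMU[OF assms(3,4)] \<sigma>])
    also have "\<dots> = (\<Sum>d\<in>decomps ?w. \<Sum>j\<le>decomp_size d.
        ganit_coeff B (fst (split_decomp j d)) *
          mould_at A (ganit_word G (fst (split_decomp j d))) *
        (ganit_coeff B (snd (split_decomp j d)) *
          mould_at C (ganit_word G (snd (split_decomp j d)))))"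
    proof (rule sum.cong[OF refl])
      fix d assume d: "d \<in> decomps ?w"
      then have vd: "valid_decomp d" by (simp add: decomps_def)
      have "mould_at (mould_times G A C) (ganit_word G d) = (\<Sum>j\<le>decomp_size d.
          mould_at A (take j (ganit_word G d)) * mould_at C (drop j (ganit_word G d)))"
        unfolding mould_at_mould_times[OF assms(3,4) good_word_ganit_word[OF assms(1) \<sigma> d]]
        by (simp only: length_ganit_word)
      moreover have "ganit_coeff B d *
          (mould_at A (take j (ganit_word G d)) * mould_at C (drop j (ganit_word G d))) =
          ganit_coeff B d1 * mould_at A (ganit_word G d1) *
          (ganit_coeff B d2 * mould_at C (ganit_word G d2))"
        if "j \<le> decomp_size d" "split_decomp j d = (d1, d2)" for j d1 d2
      proof -
        have v: "valid_decomp d1" "valid_decomp d2" "join_decomp d1 d2 = d" "decomp_size d1 = j"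
          using valid_split_decomp[OF vd, of j] join_split_decomp[OF vd, of j]
            decomp_size_split[OF vd that(1)] by (auto simp: that(2))
        have "ganit_word G d = ganit_word G d1 @ ganit_word G d2"
          using ganit_word_join[OF v(1,2), of G] v(3) by simp
        moreover have "length (ganit_word G d1) = j" by (simp only: length_ganit_word v(4))
        moreover have "ganit_coeff B d = ganit_coeff B d1 * ganit_coeff B d2"
          using ganit_coeff_join[OF v(1,2) B1] v(3) by simp
        ultimately show ?thesis by simp
      qed
      then have "(\<Sum>j\<le>decomp_size d. ganit_coeff B d *
          (mould_at A (take j (ganit_word G d)) * mould_at C (drop j (ganit_word G d)))) =
          (\<Sum>j\<le>decomp_size d.
            ganit_coeff B (fst (split_decomp j d)) *
              mould_at A (ganit_word G (fst (split_decomp j d))) *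
            (ganit_coeff B (snd (split_decomp j d)) *
              mould_at C (ganit_word G (snd (split_decomp j d)))))"
        by (intro sum.cong refl) (simp only: atMost_iff surjective_pairing[symmetric])
      ultimately show "ganit_coeff B d * mould_at (mould_times G A C) (ganit_word G d) =
          (\<Sum>j\<le>decomp_size d.
            ganit_coeff B (fst (split_decomp j d)) *
              mould_at A (ganit_word G (fst (split_decomp j d))) *
            (ganit_coeff B (snd (split_decomp j d)) *
              mould_at C (ganit_word G (snd (split_decomp j d)))))"
        by (simp only: sum_distrib_left)
    qed
    also have "\<dots> = (\<Sum>i\<le>length ?w. \<Sum>d\<in>decomps (take i ?w). \<Sum>e\<in>decomps (drop i ?w).
        ganit_coeff B d * mould_at A (ganit_word G d) *
        (ganit_coeff B e * mould_at C (ganit_word G e)))"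
      by (rule sum_decomps_cut[symmetric])
    \<comment> \<open>The prefix is renamed by \<open>id\<close> and the suffix by the shift
      \<open>(+) i\<close>. The simplification rules for \<open>id\<close> are switched off so that
      the prefix keeps the shape required by \<open>mould_at_ganit\<close>.\<close>
    also have "\<dots> = (\<Sum>i\<le>length \<sigma>.
        mould_at (ganit G B A) (take i ?w) * mould_at (ganit G B C) (drop i ?w))"
      unfolding take_generic_word drop_generic_word
      by (simp add: mould_at_ganit[OF assms(1) B(1) assms(3) tk inj_on_id]
          mould_at_ganit[OF assms(1) B(1) assms(4) dr] sum_product del: id_apply comp_id)
    also have "\<dots> = mould_times G (ganit G B A) (ganit G B C) \<sigma>"
      using \<sigma> by (simp add: mould_times_def)
    finally show ?thesis .
  qed (simp add: ganit_def mould_times_def)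
qed

text \<open>In positive depth every decomposition has a block with nonempty \<open>a\<close>, so the
  unit is evaluated at a nonempty word and gives 0.\<close>

lemma ganit_mould_one:
  assumes "group G"
  shows "ganit G B (mould_one G) = mould_one G"
proof
  fix \<sigma> :: "'a list"
  show "ganit G B (mould_one G) \<sigma> = mould_one G \<sigma>"
  proof (cases "\<sigma> \<in> lists (carrier G)")
    case \<sigma>: True
    have "mould_at (mould_one G) (ganit_word G d) = 0"
      if "\<sigma> \<noteq> []" "d \<in> ganit_decomps (generic_word \<sigma>)" for d
    proof -
      have ne: "generic_word \<sigma> \<noteq> []" using that(1) length_generic_word[of \<sigma>] by fastforce
      have "d \<in> decomps (generic_word \<sigma>)" using that(2) unfolding ganit_decomps_eq[OF ne] .
      then have "map fst (ganit_word G d) \<in> lists (carrier G)"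
        using good_word_ganit_word[OF assms \<sigma>] unfolding good_word_def by blast
      moreover have "d \<noteq> []" "\<forall>(a, b)\<in>set d. a \<noteq> []"
        using that(2) by (auto simp: ganit_decomps_def)
      then have "concat (map fst d) \<noteq> []" by (cases d) auto
      then have "map fst (ganit_word G d) \<noteq> []"
        unfolding length_0_conv[symmetric] length_map length_ganit_word .
      ultimately have "mould_one G (map fst (ganit_word G d)) = 0"
        unfolding mould_one_def by (simp only: restrict_apply' if_False)
      then show ?thesis by (simp only: mould_at_eq ratfun_subst_zero)
    qed
    then show ?thesis using \<sigma> by (simp add: ganit_def mould_one_def)
  qed (simp add: ganit_def mould_one_def)
qed

lemma ganit_mould_power:
  assumes "group G" "B \<in> GARI G" "A \<in> BIMU G"
  shows "ganit G B (mould_power G A k) = mould_power G (ganit G B A) k"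
  by (induction k)
    (simp_all add: mould_power_Suc ganit_mould_one[OF assms(1)] ganit_mould_times[OF assms]
      mould_power_in_BIMU[OF assms(3)])

theorem corollary3p8:
  fixes G :: "('g, 'b) monoid_scheme" and B :: "'g mould"
  assumes "comm_group G" and "finite (carrier G)" and "B \<in> GARI G"
  shows "\<forall>A\<in>ARI G. ganit G B (exp_times G A) = exp_times G (ganit G B A)"
proof (intro ballI ext)
  fix A \<sigma> assume A: "A \<in> ARI G"
  have G: "group G" using assms(1) by (rule comm_group.axioms(2))
  have A': "A \<in> BIMU G" using A by (simp add: ARI_def)
  show "ganit G B (exp_times G A) \<sigma> = exp_times G (ganit G B A) \<sigma>"
  proof (cases "\<sigma> \<in> lists (carrier G)")
    case \<sigma>: True
    let ?D = "decomps (generic_word \<sigma>)"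
    have bound: "length (ganit_word G d) \<le> length \<sigma>" if "d \<in> ?D" for d
      using that by (simp only: length_ganit_word) (rule decomp_size_le)
    \<comment> \<open>Multiplicativity read backwards: all powers of the image are sums over the
      same index set \<open>?D\<close>, which does not depend on \<open>k\<close>.\<close>
    have power: "mould_power G (ganit G B A) k \<sigma> = (\<Sum>d\<in>?D.
        ganit_coeff B d * mould_at (mould_power G A k) (ganit_word G d))" for k
      using ganit_eq_sum[OF mould_power_in_BIMU[OF A'] \<sigma>]
      by (simp add: ganit_mould_power[OF G assms(3) A', symmetric])
    \<comment> \<open>The vanishing is pulled back to the powers of A, evaluated at words no longer
      than \<open>\<sigma>\<close>; this avoids a separate proof that \<open>ganit G B A\<close>
      lies in \<open>ARI G\<close>.\<close>
    have zero: "mould_power G (ganit G B A) k \<sigma> = 0" if "length \<sigma> < k" for k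
      unfolding power
    proof (rule sum.neutral, rule ballI)
      fix d assume d: "d \<in> ?D"
      have "mould_power G A k (map fst (ganit_word G d)) = 0"
      proof (rule mould_power_eq_0[OF A])
        show "map fst (ganit_word G d) \<in> lists (carrier G)"
          using good_word_ganit_word[OF G \<sigma> d] by (simp only: good_word_def)
        show "length (map fst (ganit_word G d)) < k" using bound[OF d] that by (simp only: length_map)
      qed
      then show "ganit_coeff B d * mould_at (mould_power G A k) (ganit_word G d) = 0"
        by (simp only: mould_at_eq) simp
    qed
    have "ganit G B (exp_times G A) \<sigma> =
        (\<Sum>d\<in>?D. ganit_coeff B d * mould_at (exp_times G A) (ganit_word G d))"
      by (rule ganit_eq_sum[OF exp_times_in_BIMU[OF A] \<sigma>])
    \<comment> \<open>Truncating at \<open>length \<sigma>\<close> for every \<open>d\<close>,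
      rather than at the length of its own word, makes the inner range constant, so that the sums
      can be swapped.\<close>
    also have "\<dots> = (\<Sum>d\<in>?D. \<Sum>k\<le>length \<sigma>. ratfun_const (1 / fact k) *
        (ganit_coeff B d * mould_at (mould_power G A k) (ganit_word G d)))"
      by (rule sum.cong[OF refl])
        (simp add: mould_at_exp_times[OF A good_word_ganit_word[OF G \<sigma>] bound] sum_distrib_left
          mult.left_commute)
    also have "\<dots> = (\<Sum>k\<le>length \<sigma>. ratfun_const (1 / fact k) *
        mould_power G (ganit G B A) k \<sigma>)"
      by (subst sum.swap) (simp only: power sum_distrib_left)
    also have "\<dots> = Sum_any (\<lambda>k. ratfun_const (1 / fact k) * mould_power G (ganit G B A) k \<sigma>)"
      by (rule Sum_any.expand_superset[symmetric])
        (use zero in \<open>auto simp: not_le[symmetric]\<close>)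
    also have "\<dots> = exp_times G (ganit G B A) \<sigma>"
      using \<sigma> by (simp add: exp_times_def)
    finally show ?thesis .
  qed (simp add: ganit_def exp_times_def)
qed

end
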